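(* Let $c\ge 1$. Then there exist constants $M\ge\sqrt 2$ and $M',a>0$ such that, when $N\ge\max(cM,3)$ and $f\in H^s_{per}$, $s>0$, we have the inequality $$\|f-S_N(f)\|_{L^2(I)}\le M'\,(1+(\pi N)^2)^{-s/2}\,\|f\|_{H^s_{per}}+M'e^{-aN}\,\|f\|_{L^2(I)}.$$
   Context: $I=[-1,1]$ and $N$ denotes an integer. For $c>0$, the prolate spheroidal wave functions (PSWFs) $(\psi_{n,c})_{n\ge 0}$ form the orthonormal basis of $L^2(I)$ consisting of eigenfunctions of the compact integral operator $\mathcal Q_c(f)(x)=\int_{-1}^1\frac{\sin c(x-y)}{\pi(x-y)}f(y)\,dy$ on $L^2(I)$, ordered so that the corresponding eigenvalues $\lambda_n(c)$ satisfy $1>\lambda_0(c)>\lambda_1(c)>\cdots>\lambda_n(c)>\cdots$. For $f\in L^2(I)$, $S_N(f)=\sum_{n<N}\langle f,\psi_{n,c}\rangle\psi_{n,c}$ is the $N$-th partial sum of the expansion of $f$ in this basis, where $\langle f,g\rangle=\int_{-1}^1f\,\overline g$. $H^s_{per}$ is the subspace of functions in the Sobolev space $H^s(I)$ that extend into $2$-periodic functions of the same regularity, with the norm given by $$\|f\|_{H^s_{per}}^2=\sum_{k\in\mathbb Z}(1+(k\pi)^2)^s|b_k(f)|^2,\qquad b_k(f)=\frac1{\sqrt2}\int_{-1}^1f(x)e^{-i\pi kx}\,dx.$$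
   Formalization: The constant M' is allowed to depend on s (M and a depend only on c): a single M' for all s>0 is impossible, as letting s→∞ with f=e^{iπkx}, |k|<N, would put 2N−1 orthonormal functions exponentially close to an N-dimensional space. *)

theory Defs
  imports "HOL-Analysis.Analysis"
begin

section \<open>Square-integrable functions\<close>

text \<open>Elements of \<open>L\<^sup>2(A)\<close> are represented by functions; equality in \<open>L\<^sup>2(A)\<close> is equality almost
  everywhere on \<open>A\<close>, and values outside \<open>A\<close> are irrelevant.\<close>

definition L2_on :: "real set \<Rightarrow> (real \<Rightarrow> complex) set" where
  "L2_on A = {f. f \<in> borel_measurable (lebesgue_on A) \<and>
                 integrable (lebesgue_on A) (\<lambda>x. (cmod (f x))\<^sup>2)}"

abbreviation I :: "real set" where "I \<equiv> {-1..1}"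

definition L2_inner :: "(real \<Rightarrow> complex) \<Rightarrow> (real \<Rightarrow> complex) \<Rightarrow> complex" where
  "L2_inner f g = (LINT x|lebesgue_on I. f x * cnj (g x))"

definition L2_norm :: "(real \<Rightarrow> complex) \<Rightarrow> real" where
  "L2_norm f = sqrt (LINT x|lebesgue_on I. (cmod (f x))\<^sup>2)"


section \<open>Prolate spheroidal wave functions\<close>

text \<open>The diagonal value \<open>c / pi\<close> extends the kernel continuously.\<close>

definition sinc_kernel :: "real \<Rightarrow> real \<Rightarrow> real" where
  "sinc_kernel c t = (if t = 0 then c / pi else sin (c * t) / (pi * t))"

definition Q :: "real \<Rightarrow> (real \<Rightarrow> complex) \<Rightarrow> real \<Rightarrow> complex" where
  "Q c f x = (LINT y|lebesgue_on I. of_real (sinc_kernel c (x - y)) * f y)"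

definition partial_sum ::
    "(nat \<Rightarrow> real \<Rightarrow> complex) \<Rightarrow> nat \<Rightarrow> (real \<Rightarrow> complex) \<Rightarrow> real \<Rightarrow> complex" where
  "partial_sum \<psi> N f x = (\<Sum>n<N. L2_inner f (\<psi> n) * \<psi> n x)"

definition orthonormal_basis :: "(nat \<Rightarrow> real \<Rightarrow> complex) \<Rightarrow> bool" where
  "orthonormal_basis \<psi> \<longleftrightarrow>
     (\<forall>n. \<psi> n \<in> L2_on I) \<and>
     (\<forall>m n. L2_inner (\<psi> m) (\<psi> n) = (if m = n then 1 else 0)) \<and>
     (\<forall>f\<in>L2_on I. (\<lambda>N. L2_norm (\<lambda>x. f x - partial_sum \<psi> N f x)) \<longlonglongrightarrow> 0)"

text \<open>The eigenvalues are simple, so these conditions determine \<open>\<mu>\<close>, and they determine each \<open>\<psi> n\<close>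
  almost everywhere up to a factor of modulus 1, which does not affect the partial sums.\<close>

definition is_PSWF :: "real \<Rightarrow> (nat \<Rightarrow> real \<Rightarrow> complex) \<Rightarrow> (nat \<Rightarrow> real) \<Rightarrow> bool" where
  "is_PSWF c \<psi> \<mu> \<longleftrightarrow>
     orthonormal_basis \<psi> \<and>
     (\<forall>n. AE x in lebesgue_on I. Q c (\<psi> n) x = of_real (\<mu> n) * \<psi> n x) \<and>
     \<mu> 0 < 1 \<and> (\<forall>m n. m < n \<longrightarrow> \<mu> n < \<mu> m)"


section \<open>Sobolev spaces on an open set\<close>

definition test_function :: "real set \<Rightarrow> (real \<Rightarrow> real) \<Rightarrow> bool" where
  "test_function A \<phi> \<longleftrightarrow>
     (\<forall>n x. (deriv ^^ n) \<phi> differentiable (at x)) \<and>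
     compact (closure {x. \<phi> x \<noteq> 0}) \<and> closure {x. \<phi> x \<noteq> 0} \<subseteq> A"

definition weak_deriv :: "real set \<Rightarrow> nat \<Rightarrow> (real \<Rightarrow> complex) \<Rightarrow> (real \<Rightarrow> complex) \<Rightarrow> bool" where
  "weak_deriv A j f g \<longleftrightarrow>
     (\<forall>\<phi>. test_function A \<phi> \<longrightarrow>
        (LINT x|lebesgue_on A. f x * of_real ((deriv ^^ j) \<phi> x)) =
        (-1) ^ j * (LINT x|lebesgue_on A. g x * of_real (\<phi> x)))"

definition gagliardo :: "real set \<Rightarrow> real \<Rightarrow> (real \<Rightarrow> complex) \<Rightarrow> ennreal" where
  "gagliardo A \<sigma> g =
     (\<integral>\<^sup>+x. \<integral>\<^sup>+y. ennreal ((cmod (g x - g y))\<^sup>2 / \<bar>x - y\<bar> powr (1 + 2 * \<sigma>))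
        \<partial>lebesgue_on A \<partial>lebesgue_on A)"

text \<open>\<open>H\<^sup>s(A)\<close> for real \<open>s \<ge> 0\<close>, in the Sobolev--Slobodeckij form: with \<open>s = m + \<sigma>\<close>, \<open>m\<close> a natural
  number and \<open>0 \<le> \<sigma> < 1\<close>, the weak derivatives up to order \<open>m\<close> are square-integrable, and if
  \<open>\<sigma> > 0\<close> the one of order \<open>m\<close> has finite Gagliardo seminorm of order \<open>\<sigma>\<close>.\<close>

definition sobolev :: "real set \<Rightarrow> real \<Rightarrow> (real \<Rightarrow> complex) set" where
  "sobolev A s = {f \<in> L2_on A. \<exists>D :: nat \<Rightarrow> real \<Rightarrow> complex.
     (\<forall>j\<le>nat \<lfloor>s\<rfloor>. D j \<in> L2_on A \<and> weak_deriv A j f (D j)) \<and>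
     (frac s > 0 \<longrightarrow> gagliardo A (frac s) (D (nat \<lfloor>s\<rfloor>)) < \<infinity>)}"


section \<open>Periodic Sobolev spaces\<close>

text \<open>The 2-periodic extension is required to be locally in \<open>H\<^sup>s\<close> on the whole line. It agrees with
  \<open>f\<close> almost everywhere, so that \<open>f(-1) = f(1)\<close> is not imposed on representatives.\<close>

definition H_per :: "real \<Rightarrow> (real \<Rightarrow> complex) set" where
  "H_per s = {f \<in> sobolev {-1<..<1} s. \<exists>g.
     (\<forall>x. g (x + 2) = g x) \<and> (AE x in lebesgue_on I. g x = f x) \<and>
     (\<forall>R>0. g \<in> sobolev {-R<..<R} s)}"

definition fourier_coeff :: "(real \<Rightarrow> complex) \<Rightarrow> int \<Rightarrow> complex" where
  "fourier_coeff f k =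
     1 / of_real (sqrt 2) * (LINT x|lebesgue_on I. f x * exp (- \<i> * of_real (pi * of_int k * x)))"

text \<open>The norm takes values in \<open>[0, \<infinity>]\<close>, so that it needs no convergence proof to be meaningful;
  it is finite for every function in \<open>H_per s\<close>.\<close>

definition H_per_norm_sq :: "real \<Rightarrow> (real \<Rightarrow> complex) \<Rightarrow> ennreal" where
  "H_per_norm_sq s f =
     (\<Sum>\<^sub>\<infinity>k. ennreal ((1 + (of_int k * pi)\<^sup>2) powr s * (cmod (fourier_coeff f k))\<^sup>2))"

definition H_per_norm :: "real \<Rightarrow> (real \<Rightarrow> complex) \<Rightarrow> ennreal" where
  "H_per_norm s f =
     (if H_per_norm_sq s f = \<infinity> then \<infinity> else ennreal (sqrt (enn2real (H_per_norm_sq s f))))"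

end

theory Submission
  imports Defs
begin

text \<open>Split \<open>f\<close> into its Fourier modes \<open>\<bar>k\<bar> \<le> N / 500\<close> and the rest. The rest is bounded by the Sobolev norm,
  so it suffices that \<open>1 - S\<^sub>N\<close> is exponentially small on \<open>exp (\<i> \<omega> x)\<close> for \<open>\<bar>\<omega>\<bar> \<le> \<pi> N / 500\<close>.

  If \<open>\<bar>\<omega>\<bar> \<le> c\<close>, it is even superexponentially small. The kernel is nearly a polynomial, so a minimax argument
  gives \<open>\<mu> N\<close> of size about \<open>(e c / N)\<^bsup>2 N\<^esup>\<close>, and since \<open>Q\<close> is, up to a factor, \<open>F\<^sup>* F\<close> for the finite Fourier
  transform \<open>F\<close>, this makes \<open>F\<close> small in \<open>L\<^sup>2\<close> on the range of \<open>1 - S\<^sub>N\<close>; a Lipschitz bound turns this into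
  a pointwise bound.

  If \<open>\<bar>\<omega>\<bar> > c\<close>, extrapolate: \<open>exp (\<i> \<omega> x) = (1 + (exp (\<i> \<theta> x) - 1))\<^bsup>P\<^esup>\<close> with \<open>\<theta> = \<omega> / P\<close>, and the binomial
  series truncated at \<open>m = N div 6\<close> terms uses only frequencies in the band. The truncation error is exponentially
  small, and the coefficients are at most \<open>N\<^bsup>2 m\<^esup>\<close>, which the superexponential decay absorbs. Neither
  the differential operator commuting with \<open>Q\<close> nor its spectrum is needed.\<close>

section \<open>Square-integrable functions on the interval\<close>

lemma finite_measure_I: "finite_measure (lebesgue_on I)"
  by (rule finite_measure_lebesgue_on) simp

lemma measure_I: "measure (lebesgue_on I) I = 2"
  by (simp add: measure_restrict_space)

lemma L2_measurable [measurable_dest]: "f \<in> L2_on A \<Longrightarrow> f \<in> borel_measurable (lebesgue_on A)"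
  by (simp add: L2_on_def)

lemma L2_integrable_sq: "f \<in> L2_on A \<Longrightarrow> integrable (lebesgue_on A) (\<lambda>x. (cmod (f x))\<^sup>2)"
  by (simp add: L2_on_def)

lemma L2_integrable_mult:
  assumes "f \<in> L2_on A" "g \<in> L2_on A"
  shows "integrable (lebesgue_on A) (\<lambda>x. f x * cnj (g x))"
proof (rule Bochner_Integration.integrable_bound)
  show "integrable (lebesgue_on A) (\<lambda>x. (cmod (f x))\<^sup>2 + (cmod (g x))\<^sup>2)"
    using assms by (intro Bochner_Integration.integrable_add L2_integrable_sq)
  show "(\<lambda>x. f x * cnj (g x)) \<in> borel_measurable (lebesgue_on A)"
    using assms borel_measurable_continuous_onI[OF continuous_on_cnj[OF continuous_on_id, of UNIV]]
    by measurable
  have "a * b \<le> a\<^sup>2 + b\<^sup>2" if "a \<ge> 0" "b \<ge> 0" for a b :: real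
  proof -
    have "2 * (a * b) \<le> a\<^sup>2 + b\<^sup>2" using sum_squares_bound[of a b] by simp
    then show ?thesis using that by (smt (verit) mult_nonneg_nonneg)
  qed
  then show "AE x in lebesgue_on A. norm (f x * cnj (g x)) \<le> norm ((cmod (f x))\<^sup>2 + (cmod (g x))\<^sup>2)"
    by (simp add: norm_mult)
qed

lemma L2_add:
  assumes "f \<in> L2_on A" "g \<in> L2_on A"
  shows "(\<lambda>x. f x + g x) \<in> L2_on A"
  unfolding L2_on_def
proof safe
  show m: "(\<lambda>x. f x + g x) \<in> borel_measurable (lebesgue_on A)"
    using assms by measurable
  show "integrable (lebesgue_on A) (\<lambda>x. (cmod (f x + g x))\<^sup>2)"
  proof (rule Bochner_Integration.integrable_bound)
    show "integrable (lebesgue_on A) (\<lambda>x. 2 * (cmod (f x))\<^sup>2 + 2 * (cmod (g x))\<^sup>2)"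
      using assms by (intro Bochner_Integration.integrable_add integrable_mult_right L2_integrable_sq)
    show "(\<lambda>x. (cmod (f x + g x))\<^sup>2) \<in> borel_measurable (lebesgue_on A)"
      using m by measurable
    have "(cmod (a + b))\<^sup>2 \<le> 2 * (cmod a)\<^sup>2 + 2 * (cmod b)\<^sup>2" for a b
    proof -
      have "(cmod (a + b))\<^sup>2 \<le> (cmod a + cmod b)\<^sup>2"
        by (simp add: norm_triangle_ineq power_mono)
      also have "\<dots> \<le> 2 * (cmod a)\<^sup>2 + 2 * (cmod b)\<^sup>2"
        using sum_squares_bound[of "cmod a" "cmod b"] by (simp add: power2_sum)
      finally show ?thesis .
    qed
    then show "AE x in lebesgue_on A. norm ((cmod (f x + g x))\<^sup>2)
        \<le> norm (2 * (cmod (f x))\<^sup>2 + 2 * (cmod (g x))\<^sup>2)"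
      by simp
  qed
qed

lemma L2_scale:
  assumes "f \<in> L2_on A"
  shows "(\<lambda>x. a * f x) \<in> L2_on A"
  using assms unfolding L2_on_def by (auto simp: norm_mult power_mult_distrib)

lemma L2_diff:
  assumes "f \<in> L2_on A" "g \<in> L2_on A"
  shows "(\<lambda>x. f x - g x) \<in> L2_on A"
  using L2_add[OF assms(1) L2_scale[OF assms(2), of "-1"]] by simp

lemma L2_zero: "(\<lambda>x. 0) \<in> L2_on A"
  by (simp add: L2_on_def)

lemma L2_sum:
  assumes "\<And>i. i \<in> J \<Longrightarrow> f i \<in> L2_on A"
  shows "(\<lambda>x. \<Sum>i\<in>J. f i x) \<in> L2_on A"
  using assms
  by (induction J rule: infinite_finite_induct) (auto intro: L2_zero L2_add)

lemma L2_bounded: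
  assumes "f \<in> borel_measurable (lebesgue_on I)" "\<And>x. x \<in> I \<Longrightarrow> cmod (f x) \<le> B"
  shows "f \<in> L2_on I"
  unfolding L2_on_def
proof safe
  show "integrable (lebesgue_on I) (\<lambda>x. (cmod (f x))\<^sup>2)"
  proof (rule finite_measure.integrable_const_bound[OF finite_measure_I, of _ "B\<^sup>2"])
    show "AE x in lebesgue_on I. norm ((cmod (f x))\<^sup>2) \<le> B\<^sup>2"
      using assms(2) by (intro AE_I2) (auto simp: power_mono)
    show "(\<lambda>x. (cmod (f x))\<^sup>2) \<in> borel_measurable (lebesgue_on I)"
      using assms(1) by measurable
  qed
qed (use assms in auto)

lemma L2_continuous:
  assumes "continuous_on I f"
  shows "f \<in> L2_on I"
proof -
  have "bounded (f ` I)"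
    using assms by (intro compact_imp_bounded compact_continuous_image) auto
  then obtain B where "\<And>x. x \<in> I \<Longrightarrow> cmod (f x) \<le> B"
    unfolding bounded_iff by blast
  then show ?thesis
    using assms by (intro L2_bounded[of _ B] continuous_imp_measurable_on_sets_lebesgue) auto
qed

section \<open>Sesquilinearity of the inner product\<close>

lemma L2_inner_add_left:
  assumes "f \<in> L2_on I" "g \<in> L2_on I" "h \<in> L2_on I"
  shows "L2_inner (\<lambda>x. f x + g x) h = L2_inner f h + L2_inner g h"
  unfolding L2_inner_def
  using assms by (simp add: ring_distribs Bochner_Integration.integral_add L2_integrable_mult)

lemma L2_inner_scale_left: "L2_inner (\<lambda>x. a * f x) g = a * L2_inner f g"
  unfolding L2_inner_def by (simp add: mult.assoc)

lemma L2_inner_zero_left: "L2_inner (\<lambda>x. 0) g = 0"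
  unfolding L2_inner_def by simp

lemma L2_inner_cnj: "cnj (L2_inner f g) = L2_inner g f"
  unfolding L2_inner_def by (subst Bochner_Integration.integral_cnj[symmetric]) (simp add: mult.commute)

lemma L2_inner_diff_left:
  assumes "f \<in> L2_on I" "g \<in> L2_on I" "h \<in> L2_on I"
  shows "L2_inner (\<lambda>x. f x - g x) h = L2_inner f h - L2_inner g h"
  using L2_inner_add_left[OF assms(1) L2_scale[OF assms(2), of "-1"] assms(3)]
  unfolding L2_inner_scale_left by simp

lemma L2_inner_sum_left:
  assumes "\<And>i. i \<in> J \<Longrightarrow> f i \<in> L2_on I" "h \<in> L2_on I"
  shows "L2_inner (\<lambda>x. \<Sum>i\<in>J. f i x) h = (\<Sum>i\<in>J. L2_inner (f i) h)"
  using assms(1)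
proof (induction J rule: infinite_finite_induct)
  case (insert i J)
  then show ?case
    using assms(2) by (simp add: L2_inner_add_left L2_sum)
qed (auto simp: L2_inner_zero_left)

lemma L2_inner_lincomb_left:
  assumes "\<And>i. i \<in> J \<Longrightarrow> f i \<in> L2_on I" "h \<in> L2_on I"
  shows "L2_inner (\<lambda>x. \<Sum>i\<in>J. v i * f i x) h = (\<Sum>i\<in>J. v i * L2_inner (f i) h)"
  using assms by (subst L2_inner_sum_left) (auto simp: L2_scale L2_inner_scale_left)

lemma L2_inner_diff_right:
  assumes "f \<in> L2_on I" "g \<in> L2_on I" "h \<in> L2_on I"
  shows "L2_inner h (\<lambda>x. f x - g x) = L2_inner h f - L2_inner h g"
  using arg_cong[OF L2_inner_diff_left[OF assms], of cnj] by (simp only: complex_cnj_diff L2_inner_cnj)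

lemma L2_inner_lincomb_right:
  assumes "\<And>i. i \<in> J \<Longrightarrow> f i \<in> L2_on I" "h \<in> L2_on I"
  shows "L2_inner h (\<lambda>x. \<Sum>i\<in>J. v i * f i x) = (\<Sum>i\<in>J. cnj (v i) * L2_inner h (f i))"
proof -
  have "L2_inner h (\<lambda>x. \<Sum>i\<in>J. v i * f i x) = cnj (\<Sum>i\<in>J. v i * L2_inner (f i) h)"
    by (subst L2_inner_cnj[symmetric]) (simp only: L2_inner_lincomb_left[OF assms])
  also have "\<dots> = (\<Sum>i\<in>J. cnj (v i) * L2_inner h (f i))"
    by (simp add: L2_inner_cnj)
  finally show ?thesis .
qed

section \<open>The norm and its inequalities\<close>

lemma L2_norm_nonneg [simp]: "L2_norm f \<ge> 0"
  unfolding L2_norm_def by (simp add: integral_nonneg_AE)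

lemma L2_norm_sq: "(L2_norm f)\<^sup>2 = (LINT x|lebesgue_on I. (cmod (f x))\<^sup>2)"
  unfolding L2_norm_def by (simp add: integral_nonneg_AE)

lemma L2_inner_self: "L2_inner f f = of_real ((L2_norm f)\<^sup>2)"
  unfolding L2_norm_sq L2_inner_def complex_norm_square[symmetric] by (rule integral_complex_of_real)

lemma L2_norm_sq_inner: "(L2_norm f)\<^sup>2 = Re (L2_inner f f)"
  by (simp add: L2_inner_self)

lemma L2_norm_sq_diff:
  assumes "f \<in> L2_on I" "g \<in> L2_on I"
  shows "(L2_norm (\<lambda>x. f x - g x))\<^sup>2 = (L2_norm f)\<^sup>2 - 2 * Re (L2_inner f g) + (L2_norm g)\<^sup>2"
proof -
  have "Re (L2_inner g f) = Re (L2_inner f g)"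
    unfolding L2_inner_cnj[of f g, symmetric] by simp
  then show ?thesis
    unfolding L2_norm_sq_inner
    using assms by (simp add: L2_inner_diff_left L2_inner_diff_right L2_diff)
qed

lemma L2_norm_scale: "L2_norm (\<lambda>x. a * f x) = cmod a * L2_norm f"
proof -
  have "(L2_norm (\<lambda>x. a * f x))\<^sup>2 = (cmod a * L2_norm f)\<^sup>2"
    unfolding L2_norm_sq power_mult_distrib norm_mult by simp
  then show ?thesis by (simp add: power2_eq_iff_nonneg)
qed

lemma L2_cong_AE:
  assumes "AE x in lebesgue_on I. f x = g x"
    and "f \<in> borel_measurable (lebesgue_on I)" "g \<in> borel_measurable (lebesgue_on I)"
  shows "L2_norm f = L2_norm g"
proof -
  have "(LINT x|lebesgue_on I. (cmod (f x))\<^sup>2) = (LINT x|lebesgue_on I. (cmod (g x))\<^sup>2)"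
    using assms by (intro integral_cong_AE) auto
  then show ?thesis unfolding L2_norm_def by simp
qed

text \<open>With \<open>z = L2_inner f g\<close>, the squared norm of \<open>f - t * z * g\<close>
  is a nonnegative quadratic in the real parameter \<open>t\<close>: scaling by \<open>z\<close>
  makes its linear coefficient real. The choice \<open>t = 1 / (L2_norm g)^2\<close> minimizes it
  and gives the inequality.\<close>

lemma L2_cauchy_schwarz:
  assumes "f \<in> L2_on I" "g \<in> L2_on I"
  shows "cmod (L2_inner f g) \<le> L2_norm f * L2_norm g"
proof -
  define z where "z = L2_inner f g"
  have q: "0 \<le> (L2_norm f)\<^sup>2 - 2 * t * (cmod z)\<^sup>2 + t\<^sup>2 * (cmod z)\<^sup>2 * (L2_norm g)\<^sup>2" for t :: real
  proof -
    have "0 \<le> (L2_norm (\<lambda>x. f x - (of_real t * z) * g x))\<^sup>2" by simp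
    also have "\<dots> = (L2_norm f)\<^sup>2 - 2 * Re (L2_inner f (\<lambda>x. (of_real t * z) * g x))
        + (L2_norm (\<lambda>x. (of_real t * z) * g x))\<^sup>2"
      using assms by (intro L2_norm_sq_diff L2_scale)
    also have "L2_inner f (\<lambda>x. (of_real t * z) * g x) = of_real t * (cnj z * z)"
      by (subst L2_inner_cnj[symmetric], subst L2_inner_scale_left)
        (simp add: L2_inner_cnj z_def mult.assoc)
    also have "cnj z * z = of_real ((cmod z)\<^sup>2)"
      using complex_norm_square[of z] by (simp add: mult.commute)
    also have "(L2_norm (\<lambda>x. (of_real t * z) * g x))\<^sup>2 = t\<^sup>2 * (cmod z)\<^sup>2 * (L2_norm g)\<^sup>2"
      unfolding L2_norm_scale by (simp add: norm_mult power_mult_distrib)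
    finally show ?thesis by (simp add: algebra_simps)
  qed
  show ?thesis
  proof (cases "z = 0")
    case True
    then show ?thesis by (simp flip: z_def)
  next
    case False
    then have z: "(cmod z)\<^sup>2 > 0" by simp
    show ?thesis
    proof (cases "L2_norm g = 0")
      \<comment> \<open>The quadratic degenerates to an affine function of \<open>t\<close> with
        negative slope, which a large \<open>t\<close> drives below 0.\<close>
      case True
      have "0 \<le> (L2_norm f)\<^sup>2 - 2 * (((L2_norm f)\<^sup>2 + 1) / (cmod z)\<^sup>2) * (cmod z)\<^sup>2"
        using q[of "((L2_norm f)\<^sup>2 + 1) / (cmod z)\<^sup>2"] True by simp
      also have "\<dots> = (L2_norm f)\<^sup>2 - 2 * ((L2_norm f)\<^sup>2 + 1)"
        using z by simp
      finally show ?thesis by (smt (verit) zero_le_power2)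
    next
      case False
      then have g: "(L2_norm g)\<^sup>2 > 0" by simp
      have "0 \<le> (L2_norm f)\<^sup>2 - (cmod z)\<^sup>2 / (L2_norm g)\<^sup>2"
        using q[of "1 / (L2_norm g)\<^sup>2"] False by (simp add: power2_eq_square)
      then have "(cmod z)\<^sup>2 \<le> (L2_norm f * L2_norm g)\<^sup>2"
        using g by (simp add: field_simps)
      then show ?thesis
        unfolding z_def by (rule power2_le_imp_le) simp
    qed
  qed
qed

lemma L2_norm_triangle:
  assumes "f \<in> L2_on I" "g \<in> L2_on I"
  shows "L2_norm (\<lambda>x. f x + g x) \<le> L2_norm f + L2_norm g"
proof (rule power2_le_imp_le)
  have "(L2_norm (\<lambda>x. f x + g x))\<^sup>2 = (L2_norm (\<lambda>x. f x - (-1) * g x))\<^sup>2" by simp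
  also have "\<dots> = (L2_norm f)\<^sup>2 - 2 * Re (L2_inner f (\<lambda>x. (-1) * g x)) + (L2_norm (\<lambda>x. (-1) * g x))\<^sup>2"
    using assms by (intro L2_norm_sq_diff L2_scale)
  also have "L2_norm (\<lambda>x. (-1) * g x) = L2_norm g"
    by (subst L2_norm_scale) simp
  also have "- Re (L2_inner f (\<lambda>x. (-1) * g x)) \<le> L2_norm f * L2_norm g"
  proof -
    have "- Re (L2_inner f (\<lambda>x. (-1) * g x)) \<le> cmod (L2_inner f (\<lambda>x. (-1) * g x))"
      using abs_Re_le_cmod[of "L2_inner f (\<lambda>x. (-1) * g x)"] by linarith
    also have "\<dots> \<le> L2_norm f * L2_norm (\<lambda>x. (-1) * g x)"
      using assms by (intro L2_cauchy_schwarz L2_scale)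
    finally show ?thesis by (simp only: L2_norm_scale) simp
  qed
  then have "(L2_norm f)\<^sup>2 - 2 * Re (L2_inner f (\<lambda>x. (-1) * g x)) + (L2_norm g)\<^sup>2
    \<le> (L2_norm f + L2_norm g)\<^sup>2"
    by (simp only: power2_sum)
  finally show "(L2_norm (\<lambda>x. f x + g x))\<^sup>2 \<le> (L2_norm f + L2_norm g)\<^sup>2" .
qed simp

lemma L2_norm_le_sup:
  assumes "f \<in> borel_measurable (lebesgue_on I)" "\<And>x. x \<in> I \<Longrightarrow> cmod (f x) \<le> B" "B \<ge> 0"
  shows "L2_norm f \<le> sqrt 2 * B"
proof -
  have "(LINT x|lebesgue_on I. (cmod (f x))\<^sup>2) \<le> (LINT x|lebesgue_on I. B\<^sup>2)"
  proof (rule integral_mono)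
    show "integrable (lebesgue_on I) (\<lambda>x. (cmod (f x))\<^sup>2)"
      by (rule L2_integrable_sq[OF L2_bounded[OF assms(1,2)]])
    show "integrable (lebesgue_on I) (\<lambda>x. B\<^sup>2)"
      by simp
  qed (use assms in \<open>auto intro!: power_mono\<close>)
  also have "\<dots> = 2 * B\<^sup>2"
    by (simp add: measure_I)
  finally have "L2_norm f \<le> sqrt (2 * B\<^sup>2)"
    unfolding L2_norm_def by (rule real_sqrt_le_mono)
  then show ?thesis
    using assms(3) by (simp add: real_sqrt_mult)
qed

section \<open>Orthonormal families\<close>

text \<open>The index type is free because the eigenfunctions are indexed by \<open>nat\<close> and
  the Fourier modes by \<open>int\<close>.\<close>

definition orthonormal_on :: "('i \<Rightarrow> real \<Rightarrow> complex) \<Rightarrow> 'i set \<Rightarrow> bool" where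
  "orthonormal_on e J \<longleftrightarrow> (\<forall>i\<in>J. e i \<in> L2_on I) \<and>
     (\<forall>i\<in>J. \<forall>j\<in>J. L2_inner (e i) (e j) = (if i = j then 1 else 0))"

text \<open>For orthonormal \<open>e\<close> and finite \<open>J\<close> this is the projection onto
  the orthogonal complement of the span: \<open>1 - S_N\<close> for \<open>\<psi>\<close> and
  \<open>{..<N}\<close>, the Fourier tail for \<open>trig\<close>.\<close>

definition residual :: "('i \<Rightarrow> real \<Rightarrow> complex) \<Rightarrow> 'i set \<Rightarrow> (real \<Rightarrow> complex) \<Rightarrow> real \<Rightarrow> complex" where
  "residual e J f x = f x - (\<Sum>i\<in>J. L2_inner f (e i) * e i x)"

lemma L2_lincomb:
  assumes "orthonormal_on e J"
  shows "(\<lambda>x. \<Sum>i\<in>J. v i * e i x) \<in> L2_on I"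
  using assms by (intro L2_sum L2_scale) (auto simp: orthonormal_on_def)

lemma L2_residual:
  assumes "orthonormal_on e J" "f \<in> L2_on I"
  shows "residual e J f \<in> L2_on I"
  unfolding residual_def[abs_def] using assms by (intro L2_diff L2_lincomb)

lemma inner_lincomb_orthonormal:
  assumes "orthonormal_on e J" "finite J" "j \<in> J"
  shows "L2_inner (\<lambda>x. \<Sum>i\<in>J. v i * e i x) (e j) = v j"
proof -
  have "L2_inner (\<lambda>x. \<Sum>i\<in>J. v i * e i x) (e j) = (\<Sum>i\<in>J. v i * L2_inner (e i) (e j))"
    using assms by (intro L2_inner_lincomb_left) (auto simp: orthonormal_on_def)
  also have "\<dots> = (\<Sum>i\<in>J. if i = j then v i else 0)"
    using assms by (intro sum.cong) (auto simp: orthonormal_on_def)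
  finally show ?thesis using assms by simp
qed

lemma norm_lincomb_orthonormal:
  assumes "orthonormal_on e J" "finite J"
  shows "(L2_norm (\<lambda>x. \<Sum>i\<in>J. v i * e i x))\<^sup>2 = (\<Sum>i\<in>J. (cmod (v i))\<^sup>2)"
proof -
  let ?g = "\<lambda>x. \<Sum>i\<in>J. v i * e i x"
  have "of_real ((L2_norm ?g)\<^sup>2) = (\<Sum>i\<in>J. cnj (v i) * L2_inner ?g (e i))"
    unfolding L2_inner_self[symmetric]
    using assms by (intro L2_inner_lincomb_right L2_lincomb) (auto simp: orthonormal_on_def)
  also have "\<dots> = (\<Sum>i\<in>J. of_real ((cmod (v i))\<^sup>2))"
    using assms
    by (intro sum.cong refl) (simp only: inner_lincomb_orthonormal complex_norm_square mult.commute)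
  also have "\<dots> = of_real (\<Sum>i\<in>J. (cmod (v i))\<^sup>2)" by simp
  finally show ?thesis by (simp only: of_real_eq_iff)
qed

text \<open>Completing the square in each \<open>v i\<close>. The last sum measures the distance to
  the optimal coefficients and vanishes for the residual.\<close>

lemma norm_diff_lincomb:
  assumes "orthonormal_on e J" "finite J" "f \<in> L2_on I"
  shows "(L2_norm (\<lambda>x. f x - (\<Sum>i\<in>J. v i * e i x)))\<^sup>2
    = (L2_norm f)\<^sup>2 - (\<Sum>i\<in>J. (cmod (L2_inner f (e i)))\<^sup>2) + (\<Sum>i\<in>J. (cmod (v i - L2_inner f (e i)))\<^sup>2)"
proof -
  let ?g = "\<lambda>x. \<Sum>i\<in>J. v i * e i x"
  have "(L2_norm (\<lambda>x. f x - ?g x))\<^sup>2 = (L2_norm f)\<^sup>2 - 2 * Re (L2_inner f ?g) + (L2_norm ?g)\<^sup>2"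
    using assms by (intro L2_norm_sq_diff L2_lincomb)
  also have "L2_inner f ?g = (\<Sum>i\<in>J. cnj (v i) * L2_inner f (e i))"
    using assms by (intro L2_inner_lincomb_right) (auto simp: orthonormal_on_def)
  also have "(L2_norm ?g)\<^sup>2 = (\<Sum>i\<in>J. (cmod (v i))\<^sup>2)"
    by (rule norm_lincomb_orthonormal[OF assms(1,2)])
  also have "- 2 * Re (\<Sum>i\<in>J. cnj (v i) * L2_inner f (e i)) + (\<Sum>i\<in>J. (cmod (v i))\<^sup>2)
    = (\<Sum>i\<in>J. (cmod (v i - L2_inner f (e i)))\<^sup>2 - (cmod (L2_inner f (e i)))\<^sup>2)"
    unfolding Re_sum sum_distrib_left sum.distrib[symmetric]
    by (intro sum.cong refl, simp only: cmod_power2) (simp add: power2_eq_square algebra_simps)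
  then have "(L2_norm f)\<^sup>2 - 2 * Re (\<Sum>i\<in>J. cnj (v i) * L2_inner f (e i)) + (\<Sum>i\<in>J. (cmod (v i))\<^sup>2)
    = (L2_norm f)\<^sup>2 - (\<Sum>i\<in>J. (cmod (L2_inner f (e i)))\<^sup>2) + (\<Sum>i\<in>J. (cmod (v i - L2_inner f (e i)))\<^sup>2)"
    unfolding sum_subtractf by linarith
  finally show ?thesis .
qed

lemma norm_residual:
  assumes "orthonormal_on e J" "finite J" "f \<in> L2_on I"
  shows "(L2_norm (residual e J f))\<^sup>2 = (L2_norm f)\<^sup>2 - (\<Sum>i\<in>J. (cmod (L2_inner f (e i)))\<^sup>2)"
  using norm_diff_lincomb[OF assms, of "\<lambda>i. L2_inner f (e i)"] by (simp add: residual_def[abs_def])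

lemma norm_residual_le:
  assumes "orthonormal_on e J" "finite J" "f \<in> L2_on I"
  shows "L2_norm (residual e J f) \<le> L2_norm f"
proof (rule power2_le_imp_le)
  show "(L2_norm (residual e J f))\<^sup>2 \<le> (L2_norm f)\<^sup>2"
    unfolding norm_residual[OF assms] by (simp add: sum_nonneg)
qed simp

lemma residual_add:
  assumes "orthonormal_on e J" "f \<in> L2_on I" "g \<in> L2_on I"
  shows "residual e J (\<lambda>x. f x + g x) = (\<lambda>x. residual e J f x + residual e J g x)"
proof
  fix x
  have "(\<Sum>i\<in>J. L2_inner (\<lambda>x. f x + g x) (e i) * e i x)
    = (\<Sum>i\<in>J. L2_inner f (e i) * e i x + L2_inner g (e i) * e i x)"
    using assms by (intro sum.cong) (auto simp: orthonormal_on_def L2_inner_add_left algebra_simps)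
  then show "residual e J (\<lambda>x. f x + g x) x = residual e J f x + residual e J g x"
    by (simp add: residual_def sum.distrib)
qed

lemma residual_scale: "residual e J (\<lambda>x. a * f x) = (\<lambda>x. a * residual e J f x)"
  by (auto simp: residual_def L2_inner_scale_left sum_distrib_left algebra_simps)

lemma norm_residual_add:
  assumes "orthonormal_on e J" "f \<in> L2_on I" "g \<in> L2_on I"
  shows "L2_norm (residual e J (\<lambda>x. f x + g x)) \<le> L2_norm (residual e J f) + L2_norm (residual e J g)"
  unfolding residual_add[OF assms] using assms by (intro L2_norm_triangle L2_residual)

lemma norm_residual_scale: "L2_norm (residual e J (\<lambda>x. a * f x)) = cmod a * L2_norm (residual e J f)"
  unfolding residual_scale L2_norm_scale ..

text \<open>Linearity applied to \<open>f = g + (f - g)\<close>, the residual being a contraction.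
  Later replacements of a function by an approximant go through this bound.\<close>

lemma norm_residual_approx:
  assumes "orthonormal_on e J" "finite J" "f \<in> L2_on I" "g \<in> L2_on I"
  shows "L2_norm (residual e J f) \<le> L2_norm (residual e J g) + L2_norm (\<lambda>x. f x - g x)"
proof -
  have "L2_norm (residual e J (\<lambda>x. g x + (f x - g x)))
    \<le> L2_norm (residual e J g) + L2_norm (residual e J (\<lambda>x. f x - g x))"
    using assms by (intro norm_residual_add L2_diff)
  also have "L2_norm (residual e J (\<lambda>x. f x - g x)) \<le> L2_norm (\<lambda>x. f x - g x)"
    using assms by (intro norm_residual_le L2_diff)
  finally show ?thesis by simp
qed

lemma norm_residual_sum_le:
  assumes "orthonormal_on e J" "finite K" "\<And>i. i \<in> K \<Longrightarrow> f i \<in> L2_on I"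
  shows "L2_norm (residual e J (\<lambda>x. \<Sum>i\<in>K. v i * f i x)) \<le> (\<Sum>i\<in>K. cmod (v i) * L2_norm (residual e J (f i)))"
  using assms(2,3)
proof (induction K rule: finite_induct)
  case empty
  then show ?case by (simp add: residual_def[abs_def] L2_inner_zero_left L2_norm_def)
next
  case (insert i K)
  have "L2_norm (residual e J (\<lambda>x. v i * f i x + (\<Sum>i\<in>K. v i * f i x)))
    \<le> L2_norm (residual e J (\<lambda>x. v i * f i x)) + L2_norm (residual e J (\<lambda>x. \<Sum>i\<in>K. v i * f i x))"
    using insert.prems assms(1) by (intro norm_residual_add L2_scale L2_sum) auto
  then show ?case
    using insert by (fastforce simp: norm_residual_scale)
qed

text \<open>Gaussian elimination, one equation at a time.\<close>

lemma underdetermined_system: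
  fixes a :: "'i \<Rightarrow> nat \<Rightarrow> 'a::field"
  assumes "finite J" "card J > m"
  shows "\<exists>v. (\<exists>i\<in>J. v i \<noteq> 0) \<and> (\<forall>j<m. (\<Sum>i\<in>J. v i * a i j) = 0)"
  using assms
proof (induction m arbitrary: J a)
  case 0
  then obtain i where "i \<in> J" by fastforce
  then show ?case by (intro exI[of _ "\<lambda>_. 1"]) auto
next
  case (Suc m)
  show ?case
  proof (cases "\<forall>i\<in>J. a i m = 0")
    case True
    obtain v where v: "\<exists>i\<in>J. v i \<noteq> 0" "\<forall>j<m. (\<Sum>i\<in>J. v i * a i j) = 0"
      using Suc.IH[of J a] Suc.prems by auto
    have "(\<Sum>i\<in>J. v i * a i j) = 0" if "j < Suc m" for j
      using that v(2) True by (cases "j = m") auto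
    then show ?thesis using v(1) by blast
  next
    case False
    then obtain p where p: "p \<in> J" "a p m \<noteq> 0" by blast
    \<comment> \<open>\<open>b\<close> is the system after equation \<open>m\<close> has been used
      to eliminate the pivot unknown \<open>p\<close>; its own equation \<open>m\<close> is trivial,
      since \<open>b i m = 0\<close>.\<close>
    define b where "b i j = a i j - a i m / a p m * a p j" for i j
    have "card (J - {p}) > m" using Suc.prems p by simp
    then obtain v where v: "\<exists>i\<in>J - {p}. v i \<noteq> 0" "\<forall>j<m. (\<Sum>i\<in>J - {p}. v i * b i j) = 0"
      using Suc.IH[of "J - {p}" b] Suc.prems by auto
    \<comment> \<open>Back substitution: \<open>w p\<close> is the value that solves equation
      \<open>m\<close> for the pivot.\<close>
    define w where "w i = (if i = p then - (\<Sum>i\<in>J - {p}. v i * a i m) / a p m else v i)" for i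
    have split: "(\<Sum>i\<in>J. w i * a i j) = (\<Sum>i\<in>J - {p}. v i * b i j)" for j
    proof -
      have "(\<Sum>i\<in>J. w i * a i j) = w p * a p j + (\<Sum>i\<in>J - {p}. w i * a i j)"
        using p Suc.prems by (intro sum.remove) auto
      also have "(\<Sum>i\<in>J - {p}. w i * a i j) = (\<Sum>i\<in>J - {p}. v i * a i j)"
        by (intro sum.cong) (auto simp: w_def)
      also have "w p * a p j = (\<Sum>i\<in>J - {p}. - (v i * (a i m / a p m * a p j)))"
        by (simp add: w_def sum_negf sum_distrib_right sum_divide_distrib mult.assoc)
      finally show ?thesis
        by (simp add: b_def right_diff_distrib sum_subtractf sum_negf)
    qed
    have "(\<Sum>i\<in>J. w i * a i j) = 0" if "j < Suc m" for j
      using that v(2) p(2) unfolding split by (cases "j = m") (auto simp: b_def)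
    moreover have "\<exists>i\<in>J. w i \<noteq> 0" using v(1) by (auto simp: w_def)
    ultimately show ?thesis by blast
  qed
qed

section \<open>Sinc kernel and band-limited functions\<close>

definition wave :: "real \<Rightarrow> real \<Rightarrow> complex" where
  "wave \<omega> x = cis (\<omega> * x)"

text \<open>Taylor's formula of order 0; on the imaginary axis the exponential factor in its
  remainder is 1.\<close>

lemma norm_cis_minus_one: "cmod (cis \<theta> - 1) \<le> \<bar>\<theta>\<bar>"
  using Taylor_exp[of "\<i> * of_real \<theta>" 0] by (simp add: cis_conv_exp norm_mult)

lemma norm_wave_diff: "cmod (wave a x - wave b x) \<le> \<bar>a - b\<bar> * \<bar>x\<bar>"
proof -
  have "wave a x - wave b x = wave b x * (cis ((a - b) * x) - 1)"
    unfolding wave_def right_diff_distrib cis_mult by (simp add: algebra_simps)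
  then show ?thesis
    using norm_cis_minus_one[of "(a - b) * x"] by (simp add: norm_mult wave_def abs_mult)
qed

lemma norm_wave [simp]: "cmod (wave \<omega> x) = 1"
  by (simp add: wave_def)

lemma cnj_wave: "cnj (wave \<omega> x) = wave (- \<omega>) x"
  by (simp add: wave_def cis_cnj)

lemma wave_mult: "wave a x * wave b x = wave (a + b) x"
  by (simp add: wave_def cis_mult algebra_simps)

lemma wave_swap: "wave (c * x) y = wave (c * y) x"
  by (simp add: wave_def mult_ac)

lemma continuous_on_wave [continuous_intros]: "continuous_on S (wave \<omega>)"
  unfolding wave_def[abs_def] by (intro continuous_intros)

lemma L2_wave: "wave \<omega> \<in> L2_on I"
  by (intro L2_continuous continuous_intros)

lemma L2_norm_wave: "L2_norm (wave \<omega>) = sqrt 2"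
  unfolding L2_norm_def using measure_I by simp

text \<open>Cauchy-Schwarz against the difference of two waves, which is at most
  \<open>\<bar>a - b\<bar>\<close> on \<open>I\<close>. This makes the finite Fourier transform
  continuous and later keeps it from dropping quickly away from a point.\<close>

lemma inner_wave_lipschitz:
  assumes "g \<in> L2_on I"
  shows "cmod (L2_inner g (wave a) - L2_inner g (wave b)) \<le> sqrt 2 * \<bar>a - b\<bar> * L2_norm g"
proof -
  have "cmod (L2_inner g (wave a) - L2_inner g (wave b)) = cmod (L2_inner g (\<lambda>x. wave a x - wave b x))"
    using assms by (simp add: L2_inner_diff_right L2_wave)
  also have "\<dots> \<le> L2_norm g * L2_norm (\<lambda>x. wave a x - wave b x)"
    using assms by (intro L2_cauchy_schwarz L2_diff L2_wave)
  also have "\<dots> \<le> L2_norm g * (sqrt 2 * \<bar>a - b\<bar>)"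
  proof (intro mult_left_mono L2_norm_nonneg, rule L2_norm_le_sup)
    show "(\<lambda>x. wave a x - wave b x) \<in> borel_measurable (lebesgue_on I)"
      by (intro L2_measurable L2_diff L2_wave)
    show "cmod (wave a x - wave b x) \<le> \<bar>a - b\<bar>" if "x \<in> I" for x
    proof -
      have "\<bar>a - b\<bar> * \<bar>x\<bar> \<le> \<bar>a - b\<bar> * 1"
        using that by (intro mult_left_mono) auto
      then show ?thesis using norm_wave_diff[of a x b] by simp
    qed
  qed simp
  finally show ?thesis by (simp add: mult_ac)
qed

lemma continuous_on_inner_wave:
  assumes "g \<in> L2_on I"
  shows "continuous_on S (\<lambda>t. L2_inner g (wave (c * t)))"
proof (rule lipschitz_on_continuous_on)
  show "(sqrt 2 * \<bar>c\<bar> * L2_norm g)-lipschitz_on S (\<lambda>t. L2_inner g (wave (c * t)))"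
  proof (rule lipschitz_onI)
    fix x y
    show "dist (L2_inner g (wave (c * x))) (L2_inner g (wave (c * y)))
      \<le> sqrt 2 * \<bar>c\<bar> * L2_norm g * dist x y"
      using inner_wave_lipschitz[OF assms, of "c * x" "c * y"]
      by (simp add: dist_norm abs_mult mult_ac flip: right_diff_distrib)
  qed simp
qed

lemma inner_wave_le:
  assumes "g \<in> L2_on I"
  shows "cmod (L2_inner g (wave \<omega>)) \<le> sqrt 2 * L2_norm g"
  using L2_cauchy_schwarz[OF assms L2_wave[of \<omega>]] by (simp add: L2_norm_wave mult.commute)

lemma L2_inner_wave: "g \<in> L2_on I \<Longrightarrow> (\<lambda>t. L2_inner g (wave (c * t))) \<in> L2_on I"
  by (rule L2_continuous[OF continuous_on_inner_wave])

lemma integral_wave: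
  "(LINT x|lebesgue_on I. wave \<omega> x) = (if \<omega> = 0 then 2 else of_real (2 * sin \<omega> / \<omega>))"
proof (cases "\<omega> = 0")
  case True
  then show ?thesis using measure_I by (simp add: wave_def scaleR_conv_of_real)
next
  case False
  define F where "F z = exp (\<i> * of_real \<omega> * z) / (\<i> * of_real \<omega>)" for z :: complex
  have "((\<lambda>x. F (of_real x)) has_vector_derivative wave \<omega> x) (at x within I)" for x
    unfolding F_def[abs_def] using False
    by (intro has_vector_derivative_real_field)
      (auto intro!: derivative_eq_intros simp: wave_def cis_conv_exp mult.assoc)
  then have "(wave \<omega> has_integral (F (of_real 1) - F (of_real (- 1)))) I"
    by (intro fundamental_theorem_of_calculus) auto
  then have "integral I (wave \<omega>) = F (of_real 1) - F (of_real (- 1))"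
    by (rule integral_unique)
  also have "\<dots> = (cis \<omega> - cis (- \<omega>)) / (\<i> * of_real \<omega>)"
    by (simp add: F_def cis_conv_exp diff_divide_distrib)
  also have "cis \<omega> - cis (- \<omega>) = \<i> * of_real (2 * sin \<omega>)"
    by (simp add: complex_eq_iff)
  finally have "integral I (wave \<omega>) = of_real (2 * sin \<omega> / \<omega>)"
    using False by simp
  moreover have "integrable (lebesgue_on I) (wave \<omega>)"
    by (intro continuous_imp_integrable_real continuous_intros)
  ultimately show ?thesis
    using False by (subst lebesgue_integral_eq_integral) auto
qed

lemma inner_wave_wave:
  "L2_inner (wave a) (wave b) = (if a = b then 2 else of_real (2 * sin (a - b) / (a - b)))"
  unfolding L2_inner_def cnj_wave wave_mult integral_wave by simp

text \<open>The sinc kernel is the Fourier transform of the indicator of the band, here rescaled to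
  \<open>I\<close>. Written as an integral of products of waves, it exhibits \<open>Q\<close> as a
  finite Fourier transform followed by its adjoint.\<close>

lemma sinc_kernel_eq:
  assumes "c > 0"
  shows "of_real (sinc_kernel c (x - y)) = of_real (c / (2 * pi)) *
    (LINT t|lebesgue_on I. wave (c * x) t * cnj (wave (c * y) t))"
proof -
  have "c * x + - (c * y) = c * (x - y)" by (simp add: algebra_simps)
  then show ?thesis
    using assms unfolding cnj_wave wave_mult integral_wave sinc_kernel_def by simp
qed

section \<open>Fubini's theorem and the operator \<open>Q\<close>\<close>

lemma Fubini_on_I:
  fixes f :: "real \<Rightarrow> real \<Rightarrow> complex"
  assumes f: "(\<lambda>(t, y). f t y) \<in> borel_measurable (lebesgue_on I \<Otimes>\<^sub>M lebesgue_on I)"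
    and g: "g \<in> L2_on I"
    and le: "\<And>t y. t \<in> I \<Longrightarrow> y \<in> I \<Longrightarrow> cmod (f t y) \<le> B * cmod (g y)"
  shows "(LINT y|lebesgue_on I. LINT t|lebesgue_on I. f t y) = (LINT t|lebesgue_on I. LINT y|lebesgue_on I. f t y)"
proof -
  interpret finite_measure "lebesgue_on I" by (rule finite_measure_I)
  note sf = sigma_finite_measure_axioms
  interpret pair_sigma_finite "lebesgue_on I" "lebesgue_on I" ..
  \<comment> \<open>Pairing with the constant 1 shows that \<open>g\<close> is integrable,
    \<open>I\<close> having finite measure; \<open>B * cmod (g y)\<close> can then serve as
    dominating function for every \<open>t\<close>.\<close>
  have "integrable (lebesgue_on I) (\<lambda>y. g y * cnj 1)"
    by (rule L2_integrable_mult[OF g L2_continuous[OF continuous_on_const]])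
  then have gi: "integrable (lebesgue_on I) (\<lambda>y. B * cmod (g y))"
    by simp
  have fm: "(\<lambda>y. f t y) \<in> borel_measurable (lebesgue_on I)" if "t \<in> I" for t
    using measurable_Pair2[OF f, of t] that by simp
  have fi: "integrable (lebesgue_on I) (\<lambda>y. f t y)" if "t \<in> I" for t
    by (rule Bochner_Integration.integrable_bound[OF gi])
      (use le that fm in \<open>auto intro!: AE_I2 order_trans[OF le]\<close>)
  have "integrable (lebesgue_on I \<Otimes>\<^sub>M lebesgue_on I) (\<lambda>(t, y). f t y)"
  proof (rule Fubini_integrable[OF f])
    show "AE t in lebesgue_on I. integrable (lebesgue_on I) (\<lambda>y. case (t, y) of (t, y) \<Rightarrow> f t y)"
      using fi by (intro AE_I2) simp
    show "integrable (lebesgue_on I) (\<lambda>t. LINT y|lebesgue_on I. norm (case (t, y) of (t, y) \<Rightarrow> f t y))"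
    proof (rule integrable_const_bound[of _ "LINT y|lebesgue_on I. B * cmod (g y)"])
      show "AE t in lebesgue_on I. norm (LINT y|lebesgue_on I. norm (case (t, y) of (t, y) \<Rightarrow> f t y))
        \<le> (LINT y|lebesgue_on I. B * cmod (g y))"
      proof (intro AE_I2)
        fix t assume "t \<in> space (lebesgue_on I)"
        then have t: "t \<in> I" by simp
        have "norm (LINT y|lebesgue_on I. cmod (f t y)) = (LINT y|lebesgue_on I. cmod (f t y))"
          by (simp add: integral_nonneg_AE)
        also have "\<dots> \<le> (LINT y|lebesgue_on I. B * cmod (g y))"
          using t by (intro integral_mono gi integrable_norm fi le) auto
        finally show "norm (LINT y|lebesgue_on I. norm (case (t, y) of (t, y) \<Rightarrow> f t y))
          \<le> (LINT y|lebesgue_on I. B * cmod (g y))" by simp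
      qed
      have "(\<lambda>p. cmod (case p of (t, y) \<Rightarrow> f t y)) \<in> borel_measurable (lebesgue_on I \<Otimes>\<^sub>M lebesgue_on I)"
        using f by measurable
      then show "(\<lambda>t. LINT y|lebesgue_on I. norm (case (t, y) of (t, y) \<Rightarrow> f t y))
        \<in> borel_measurable (lebesgue_on I)"
        using sigma_finite_measure.borel_measurable_lebesgue_integral[OF sf, of "\<lambda>t y. cmod (f t y)" "lebesgue_on I"]
        by (simp add: case_prod_unfold)
    qed
  qed
  then show ?thesis by (rule Fubini_integral)
qed

lemma wave_measurable_pair [measurable]:
  "(\<lambda>(t, y). wave (c * y) t) \<in> borel_measurable (lebesgue_on I \<Otimes>\<^sub>M lebesgue_on I)"
proof -
  have [measurable]: "(\<lambda>x. x) \<in> borel_measurable (lebesgue_on I)"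
    by (intro continuous_imp_measurable_on_sets_lebesgue continuous_intros) auto
  have [measurable]: "cis \<in> borel_measurable borel"
    by (intro borel_measurable_continuous_onI continuous_intros)
  have "fst \<in> borel_measurable (lebesgue_on I \<Otimes>\<^sub>M lebesgue_on I)"
    by (rule measurable_compose[OF measurable_fst, of "\<lambda>x. x", simplified]) measurable
  moreover have "snd \<in> borel_measurable (lebesgue_on I \<Otimes>\<^sub>M lebesgue_on I)"
    by (rule measurable_compose[OF measurable_snd, of "\<lambda>x. x", simplified]) measurable
  ultimately show ?thesis
    unfolding wave_def case_prod_unfold by measurable
qed

lemma Q_eq_inner:
  assumes c: "c > 0" and g: "g \<in> L2_on I"
  shows "Q c g x = of_real (c / (2 * pi)) * (LINT t|lebesgue_on I. wave (c * x) t * L2_inner g (wave (c * t)))"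
proof -
  have [measurable]: "g \<in> borel_measurable (lebesgue_on I)"
    by (rule L2_measurable[OF g])
  have [measurable]: "wave \<omega> \<in> borel_measurable (lebesgue_on I)" for \<omega>
    by (rule L2_measurable[OF L2_wave])
  have "Q c g x = (LINT y|lebesgue_on I. of_real (c / (2 * pi)) *
      (LINT t|lebesgue_on I. wave (c * x) t * (g y * wave (- c * y) t)))"
    unfolding Q_def sinc_kernel_eq[OF c]
    by (simp add: cnj_wave mult_ac flip: integral_mult_right_zero integral_mult_left_zero)
  also have "\<dots> = of_real (c / (2 * pi)) *
      (LINT y|lebesgue_on I. LINT t|lebesgue_on I. wave (c * x) t * (g y * wave (- c * y) t))"
    by simp
  also have "(LINT y|lebesgue_on I. LINT t|lebesgue_on I. wave (c * x) t * (g y * wave (- c * y) t))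
    = (LINT t|lebesgue_on I. LINT y|lebesgue_on I. wave (c * x) t * (g y * wave (- c * y) t))"
  proof (rule Fubini_on_I[OF _ g, of _ 1])
    show "(\<lambda>(t, y). wave (c * x) t * (g y * wave (- c * y) t)) \<in> borel_measurable (lebesgue_on I \<Otimes>\<^sub>M lebesgue_on I)"
      using wave_measurable_pair[of "-c"] by (simp add: case_prod_unfold)
  qed (simp add: norm_mult)
  also have "\<dots> = (LINT t|lebesgue_on I. wave (c * x) t * L2_inner g (wave (c * t)))"
    unfolding L2_inner_def by (simp add: cnj_wave wave_swap[of "-c" _ , simplified])
  finally show ?thesis .
qed

text \<open>The outer integral is again an inner product with a wave, so continuity and linearity of
  \<open>Q\<close> follow from those of the transform.\<close>

lemma Q_eq_inner_inner:
  assumes "c > 0" "g \<in> L2_on I"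
  shows "Q c g = (\<lambda>x. of_real (c / (2 * pi)) * L2_inner (\<lambda>t. L2_inner g (wave (c * t))) (wave (- c * x)))"
  unfolding Q_eq_inner[OF assms, abs_def] L2_inner_def cnj_wave by (simp add: mult.commute fun_eq_iff)

lemma continuous_on_Q:
  assumes "c > 0" "g \<in> L2_on I"
  shows "continuous_on S (Q c g)"
  unfolding Q_eq_inner_inner[OF assms]
  by (intro continuous_on_mult_const continuous_intros continuous_on_inner_wave L2_inner_wave assms)

lemma Q_lincomb:
  assumes c: "c > 0" and f: "\<And>i. i \<in> J \<Longrightarrow> f i \<in> L2_on I"
  shows "Q c (\<lambda>x. \<Sum>i\<in>J. v i * f i x) x = (\<Sum>i\<in>J. v i * Q c (f i) x)"
proof -
  have "(\<lambda>t. L2_inner (\<lambda>x. \<Sum>i\<in>J. v i * f i x) (wave (c * t)))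
      = (\<lambda>t. \<Sum>i\<in>J. v i * L2_inner (f i) (wave (c * t)))"
    using f by (simp add: L2_inner_lincomb_left L2_wave)
  then have "Q c (\<lambda>x. \<Sum>i\<in>J. v i * f i x) x
      = of_real (c / (2 * pi)) * L2_inner (\<lambda>t. \<Sum>i\<in>J. v i * L2_inner (f i) (wave (c * t))) (wave (- c * x))"
    using f by (subst Q_eq_inner_inner[OF c]) (auto intro!: L2_sum L2_scale)
  also have "L2_inner (\<lambda>t. \<Sum>i\<in>J. v i * L2_inner (f i) (wave (c * t))) (wave (- c * x))
      = (\<Sum>i\<in>J. v i * L2_inner (\<lambda>t. L2_inner (f i) (wave (c * t))) (wave (- c * x)))"
    using f by (intro L2_inner_lincomb_left L2_inner_wave L2_wave)
  also have "of_real (c / (2 * pi)) * \<dots> = (\<Sum>i\<in>J. v i * Q c (f i) x)"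
    unfolding sum_distrib_left using f
    by (intro sum.cong refl) (simp add: Q_eq_inner_inner[OF c])
  finally show ?thesis .
qed

text \<open>Fubini moves the outer transform onto \<open>g\<close>, leaving the squared norm of a
  single transform. This makes \<open>Q\<close> positive and ties its eigenvalues to the size of the
  transform.\<close>

lemma inner_Q_self:
  assumes c: "c > 0" and g: "g \<in> L2_on I"
  shows "L2_inner (Q c g) g = of_real (c / (2 * pi) * (L2_norm (\<lambda>t. L2_inner g (wave (c * t))))\<^sup>2)"
proof -
  let ?H = "\<lambda>t. L2_inner g (wave (c * t))"
  have [measurable]: "g \<in> borel_measurable (lebesgue_on I)"
    by (rule L2_measurable[OF g])
  have [measurable]: "?H \<in> borel_measurable (lebesgue_on I)"
    by (rule L2_measurable[OF L2_inner_wave[OF g]])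
  have "L2_inner (Q c g) g = of_real (c / (2 * pi)) *
      (LINT x|lebesgue_on I. LINT t|lebesgue_on I. wave (c * x) t * (?H t * cnj (g x)))"
    unfolding Q_eq_inner[OF c g] L2_inner_def[of _ g]
    by (simp add: mult.assoc flip: integral_mult_right_zero integral_mult_left_zero)
  also have "(LINT x|lebesgue_on I. LINT t|lebesgue_on I. wave (c * x) t * (?H t * cnj (g x)))
    = (LINT t|lebesgue_on I. LINT x|lebesgue_on I. wave (c * x) t * (?H t * cnj (g x)))"
  proof (rule Fubini_on_I[OF _ g, of _ "sqrt 2 * L2_norm g"])
    have [measurable]: "(\<lambda>x. cnj (g x)) \<in> borel_measurable (lebesgue_on I)"
      using borel_measurable_continuous_onI[OF continuous_on_cnj[OF continuous_on_id, of UNIV]] by measurable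
    show "(\<lambda>(t, x). wave (c * x) t * (?H t * cnj (g x))) \<in> borel_measurable (lebesgue_on I \<Otimes>\<^sub>M lebesgue_on I)"
      using wave_measurable_pair[of c] by (simp add: case_prod_unfold)
    show "cmod (wave (c * x) t * (?H t * cnj (g x))) \<le> sqrt 2 * L2_norm g * cmod (g x)" for t x
      using inner_wave_le[OF g, of "c * t"] by (simp add: norm_mult mult_right_mono)
  qed
  also have "\<dots> = (LINT t|lebesgue_on I. ?H t * cnj (?H t))"
  proof (intro Bochner_Integration.integral_cong refl)
    fix t
    have "(LINT x|lebesgue_on I. wave (c * x) t * (?H t * cnj (g x)))
      = (LINT x|lebesgue_on I. ?H t * (wave (c * t) x * cnj (g x)))"
      by (simp only: wave_swap[of c _ t] mult.left_commute)
    then show "(LINT x|lebesgue_on I. wave (c * x) t * (?H t * cnj (g x))) = ?H t * cnj (?H t)"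
      unfolding L2_inner_cnj L2_inner_def[of "wave _"] by simp
  qed
  also have "\<dots> = of_real ((L2_norm ?H)\<^sup>2)"
    by (metis L2_inner_self L2_inner_def)
  finally show ?thesis by simp
qed

section \<open>Decay of the eigenvalues\<close>

lemma interval_norm_sq_ge:
  assumes "g \<in> L2_on I" "-1 \<le> a" "a \<le> b" "b \<le> 1" "B \<ge> 0"
    and le: "\<And>t. t \<in> {a..b} \<Longrightarrow> B \<le> cmod (g t)"
  shows "(b - a) * B\<^sup>2 \<le> (L2_norm g)\<^sup>2"
proof -
  have sub: "{a..b} \<subseteq> I" using assms by auto
  have [measurable]: "{a..b} \<in> sets (lebesgue_on I)"
    using sub by (simp add: sets_restrict_space_iff)
  have "(LINT t|lebesgue_on I. indicator {a..b} t * B\<^sup>2) \<le> (LINT t|lebesgue_on I. (cmod (g t))\<^sup>2)"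
  proof (rule integral_mono)
    show "integrable (lebesgue_on I) (\<lambda>t. indicator {a..b} t * B\<^sup>2)"
    proof (rule finite_measure.integrable_const_bound[OF finite_measure_I, of _ "B\<^sup>2"])
      show "(\<lambda>t. indicator {a..b} t * B\<^sup>2) \<in> borel_measurable (lebesgue_on I)"
        by measurable
    qed (auto simp: indicator_def)
    show "integrable (lebesgue_on I) (\<lambda>t. (cmod (g t))\<^sup>2)"
      by (rule L2_integrable_sq[OF assms(1)])
    show "indicator {a..b} t * B\<^sup>2 \<le> (cmod (g t))\<^sup>2" for t
      using le[of t] \<open>B \<ge> 0\<close> by (auto simp: indicator_def intro!: power_mono)
  qed
  moreover have "(LINT t|lebesgue_on I. indicator {a..b} t * B\<^sup>2) = (b - a) * B\<^sup>2"
    using sub assms by (simp add: measure_restrict_space)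
  ultimately show ?thesis by (simp only: L2_norm_sq)
qed

section \<open>Prolate spheroidal wave functions and their eigenvalues\<close>

locale pswf =
  fixes c :: real and \<psi> :: "nat \<Rightarrow> real \<Rightarrow> complex" and \<mu> :: "nat \<Rightarrow> real"
  assumes c_pos: "c > 0" and pswf: "is_PSWF c \<psi> \<mu>"
begin

lemma L2_psi: "\<psi> n \<in> L2_on I"
  using pswf by (auto simp: is_PSWF_def orthonormal_basis_def)

lemma orthonormal_psi: "orthonormal_on \<psi> J"
  using pswf by (auto simp: is_PSWF_def orthonormal_basis_def orthonormal_on_def)

lemma eigen: "AE x in lebesgue_on I. Q c (\<psi> n) x = of_real (\<mu> n) * \<psi> n x"
  using pswf by (auto simp: is_PSWF_def)

lemma mu_less: "m < n \<Longrightarrow> \<mu> n < \<mu> m"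
  using pswf by (auto simp: is_PSWF_def)

lemma mu_mono: "m \<le> n \<Longrightarrow> \<mu> n \<le> \<mu> m"
  using mu_less[of m n] by (cases "m = n") auto

lemma partial_sum_eq: "(\<lambda>x. f x - partial_sum \<psi> N f x) = residual \<psi> {..<N} f"
  by (simp add: residual_def[abs_def] partial_sum_def)

lemma residual_tendsto_0:
  assumes "f \<in> L2_on I"
  shows "(\<lambda>N. L2_norm (residual \<psi> {..<N} f)) \<longlonglongrightarrow> 0"
  using pswf assms unfolding partial_sum_eq[symmetric] by (auto simp: is_PSWF_def orthonormal_basis_def)

lemma L2_psi_lincomb: "(\<lambda>x. \<Sum>n\<in>J. v n * \<psi> n x) \<in> L2_on I"
  by (rule L2_lincomb[OF orthonormal_psi])

text \<open>The quadratic form of \<open>inner_Q_self\<close> is diagonal in the eigenfunctions. On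
  the leading ones it serves to bound \<open>\<mu>\<close> by the transform, on the tails to bound
  the transform by \<open>\<mu>\<close>.\<close>

lemma norm_fourier_psi_lincomb:
  assumes "finite J"
  shows "c / (2 * pi) * (L2_norm (\<lambda>t. L2_inner (\<lambda>x. \<Sum>n\<in>J. v n * \<psi> n x) (wave (c * t))))\<^sup>2
    = (\<Sum>n\<in>J. \<mu> n * (cmod (v n))\<^sup>2)" (is "?l = ?r")
proof -
  let ?g = "\<lambda>x. \<Sum>n\<in>J. v n * \<psi> n x"
  have "AE x in lebesgue_on I. \<forall>n\<in>J. Q c (\<psi> n) x = of_real (\<mu> n) * \<psi> n x"
    using assms eigen by (simp add: AE_finite_all)
  then have ae: "AE x in lebesgue_on I. Q c ?g x = (\<Sum>n\<in>J. (v n * of_real (\<mu> n)) * \<psi> n x)"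
    by eventually_elim (simp add: Q_lincomb[OF c_pos L2_psi] mult.assoc)
  have Qm: "Q c ?g \<in> L2_on I"
    by (intro L2_continuous continuous_on_Q c_pos L2_psi_lincomb)
  have "of_real ?l = L2_inner (Q c ?g) ?g"
    by (rule inner_Q_self[OF c_pos L2_psi_lincomb, symmetric])
  also have "\<dots> = L2_inner (\<lambda>x. \<Sum>n\<in>J. (v n * of_real (\<mu> n)) * \<psi> n x) ?g"
    unfolding L2_inner_def
    using ae Qm
    by (intro integral_cong_AE borel_measurable_integrable L2_integrable_mult L2_psi_lincomb)
       (auto elim: eventually_mono)
  also have "\<dots> = (\<Sum>n\<in>J. cnj (v n) * L2_inner (\<lambda>x. \<Sum>n\<in>J. (v n * of_real (\<mu> n)) * \<psi> n x) (\<psi> n))"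
    by (rule L2_inner_lincomb_right[OF L2_psi L2_psi_lincomb])
  also have "\<dots> = (\<Sum>n\<in>J. cnj (v n) * (v n * of_real (\<mu> n)))"
    using assms by (intro sum.cong refl) (simp add: inner_lincomb_orthonormal[OF orthonormal_psi])
  also have "\<dots> = (\<Sum>n\<in>J. of_real (\<mu> n) * of_real ((cmod (v n))\<^sup>2))"
    unfolding complex_norm_square by (simp add: mult_ac)
  also have "\<dots> = of_real ?r" by simp
  finally show ?thesis by (simp only: of_real_eq_iff)
qed

text \<open>The quadratic form gives only nonnegativity; strictness comes from the strict decrease,
  with nonnegativity applied to the next index.\<close>

lemma mu_pos: "\<mu> n > 0"
proof -
  have "\<mu> (Suc n) \<ge> 0"
    using norm_fourier_psi_lincomb[of "{Suc n}" "\<lambda>_. 1"] c_pos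
    by (simp add: zero_le_mult_iff flip: of_nat_Suc)
      (metis divide_nonneg_nonneg less_eq_real_def mult_nonneg_nonneg pi_ge_zero zero_le_numeral zero_le_power2)
  then show ?thesis using mu_less[of n "Suc n"] by simp
qed

text \<open>Some nonzero combination of the first eigenfunctions is orthogonal to all monomials of low
  degree, hence almost orthogonal to every frequency in the band.\<close>

lemma mu_le: "\<mu> (Suc N) \<le> 2 * c / pi * (c ^ Suc N / fact N)\<^sup>2"
proof -
  define J where "J = {..Suc N}"
  have J: "finite J" by (simp add: J_def)
  \<comment> \<open>\<open>J\<close> has \<open>N + 2\<close> elements, one more than the
    \<open>N + 1\<close> moment conditions for the degrees 0 to \<open>N\<close>.\<close>
  obtain v where v0: "\<exists>n\<in>J. v n \<noteq> 0"
    and v: "\<forall>j<Suc N. (\<Sum>n\<in>J. v n * L2_inner (\<psi> n) (\<lambda>x. of_real (x ^ j))) = 0"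
    using underdetermined_system[of J "Suc N" "\<lambda>n j. L2_inner (\<psi> n) (\<lambda>x. of_real (x ^ j))"]
    by (auto simp: J_def)
  define g where "g x = (\<Sum>n\<in>J. v n * \<psi> n x)" for x
  have g2: "g \<in> L2_on I" unfolding g_def[abs_def] by (rule L2_psi_lincomb)
  have mono2: "(\<lambda>x. of_real (x ^ j)) \<in> L2_on I" for j
    by (intro L2_continuous continuous_intros)
  have orth: "L2_inner g (\<lambda>x. of_real (x ^ j)) = 0" if "j \<le> N" for j
    unfolding g_def[abs_def] using v that by (subst L2_inner_lincomb_left[OF L2_psi mono2]) auto
  define r where "r = c ^ Suc N / fact N"
  have r0: "r > 0" using c_pos by (simp add: r_def)
  have H: "cmod (L2_inner g (wave (c * t))) \<le> sqrt 2 * r * L2_norm g" if t: "t \<in> I" for t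
  proof -
    \<comment> \<open>\<open>p\<close> is the Taylor polynomial of degree \<open>N\<close> of the
      wave; it drops out of the inner product with \<open>g\<close>, and only the remainder, at most
      \<open>r\<close>, is left.\<close>
    define p where "p x = (\<Sum>j\<le>N. (\<i> * of_real (c * t)) ^ j / fact j * of_real (x ^ j))" for x :: real
    have p2: "p \<in> L2_on I"
      unfolding p_def[abs_def] by (intro L2_sum L2_scale mono2)
    have "L2_inner g p = 0"
      unfolding p_def[abs_def] using orth by (subst L2_inner_lincomb_right[OF mono2 g2]) auto
    then have "L2_inner g (wave (c * t)) = L2_inner g (\<lambda>x. wave (c * t) x - p x)"
      using g2 p2 by (simp add: L2_inner_diff_right L2_wave)
    also have "cmod \<dots> \<le> L2_norm g * L2_norm (\<lambda>x. wave (c * t) x - p x)"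
      using g2 p2 by (intro L2_cauchy_schwarz L2_diff L2_wave)
    also have "\<dots> \<le> L2_norm g * (sqrt 2 * r)"
    proof (intro mult_left_mono L2_norm_nonneg, rule L2_norm_le_sup)
      show "(\<lambda>x. wave (c * t) x - p x) \<in> borel_measurable (lebesgue_on I)"
        using p2 by (intro L2_measurable L2_diff L2_wave)
      show "cmod (wave (c * t) x - p x) \<le> r" if x: "x \<in> I" for x
      proof -
        have "cmod (wave (c * t) x - p x) \<le> \<bar>c * t * x\<bar> ^ Suc N / fact N"
          using Taylor_exp[of "\<i> * of_real (c * t * x)" N]
          by (simp add: wave_def cis_conv_exp p_def norm_mult abs_mult power_mult_distrib field_simps
              flip: power_Suc)
        also have "\<dots> \<le> c ^ Suc N / fact N"
        proof (intro divide_right_mono power_mono)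
          have "\<bar>t * x\<bar> \<le> 1" using t x by (auto simp: abs_mult intro: mult_le_one)
          then show "\<bar>c * t * x\<bar> \<le> c"
            using c_pos mult_left_mono[of "\<bar>t * x\<bar>" 1 c] by (simp add: abs_mult mult.assoc)
        qed auto
        finally show ?thesis by (simp add: r_def)
      qed
    qed (use r0 in simp)
    finally show ?thesis by (simp add: mult_ac)
  qed
  have Hn: "L2_norm (\<lambda>t. L2_inner g (wave (c * t))) \<le> 2 * r * L2_norm g"
  proof -
    have "L2_norm (\<lambda>t. L2_inner g (wave (c * t))) \<le> sqrt 2 * (sqrt 2 * r * L2_norm g)"
      using H r0 by (intro L2_norm_le_sup L2_measurable L2_inner_wave g2) auto
    also have "\<dots> = (sqrt 2 * sqrt 2) * r * L2_norm g" by (simp only: mult.assoc)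
    finally show ?thesis by simp
  qed
  have gn: "(L2_norm g)\<^sup>2 = (\<Sum>n\<in>J. (cmod (v n))\<^sup>2)"
    unfolding g_def[abs_def] by (rule norm_lincomb_orthonormal[OF orthonormal_psi J])
  have pos: "(L2_norm g)\<^sup>2 > 0"
    unfolding gn using v0 J by (auto intro!: sum_pos2)
  \<comment> \<open>Minimax: on the span of the eigenfunctions up to \<open>Suc N\<close> the
    quadratic form is at least \<open>\<mu> (Suc N)\<close> times the squared norm, while the
    transform of \<open>g\<close> bounds it from above.\<close>
  have "\<mu> (Suc N) * (L2_norm g)\<^sup>2 = (\<Sum>n\<in>J. \<mu> (Suc N) * (cmod (v n))\<^sup>2)"
    unfolding gn by (simp add: sum_distrib_left)
  also have "\<dots> \<le> (\<Sum>n\<in>J. \<mu> n * (cmod (v n))\<^sup>2)"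
    by (intro sum_mono mult_right_mono mu_mono) (auto simp: J_def)
  also have "\<dots> = c / (2 * pi) * (L2_norm (\<lambda>t. L2_inner g (wave (c * t))))\<^sup>2"
    unfolding g_def[abs_def] by (rule norm_fourier_psi_lincomb[OF J, symmetric])
  also have "\<dots> \<le> c / (2 * pi) * (2 * r * L2_norm g)\<^sup>2"
    using Hn c_pos by (intro mult_left_mono power_mono) auto
  also have "\<dots> = (2 * c / pi * r\<^sup>2) * (L2_norm g)\<^sup>2"
    by (simp add: power2_eq_square)
  finally show ?thesis
    using pos unfolding r_def by (rule mult_right_le_imp_le)
qed

text \<open>The transform \<open>H\<close> of the tail \<open>h\<close> takes the value \<open>\<parallel>h\<parallel>\<^sup>2\<close> at \<open>t0\<close> and is Lipschitz, whereas
  its \<open>L\<^sup>2\<close> norm is controlled by \<open>\<mu> N\<close>.\<close>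

lemma tail_wave_cube_le:
  assumes J: "finite J" "J \<subseteq> {N..}" and t0: "\<bar>t0\<bar> \<le> 1" and c: "c \<ge> 1"
  defines "h \<equiv> \<lambda>x. \<Sum>n\<in>J. L2_inner (wave (c * t0)) (\<psi> n) * \<psi> n x"
  shows "(L2_norm h) ^ 3 \<le> 16 * sqrt 2 * pi * \<mu> N"
proof (cases "L2_norm h = 0")
  case True
  then show ?thesis using mu_pos[of N] by simp
next
  case False
  define r where "r = L2_norm h"
  define H where "H t = L2_inner h (wave (c * t))" for t
  have r: "r > 0" using False L2_norm_nonneg[of h] unfolding r_def by linarith
  have h2: "h \<in> L2_on I" unfolding h_def by (rule L2_psi_lincomb)
  have rsq: "r\<^sup>2 = (\<Sum>n\<in>J. (cmod (L2_inner (wave (c * t0)) (\<psi> n)))\<^sup>2)"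
    unfolding r_def h_def by (rule norm_lincomb_orthonormal[OF orthonormal_psi J(1)])
  \<comment> \<open>Bessel's inequality for the wave, whose squared norm is 2.\<close>
  have "(L2_norm (residual \<psi> J (wave (c * t0))))\<^sup>2 = 2 - r\<^sup>2"
    unfolding norm_residual[OF orthonormal_psi J(1) L2_wave] rsq by (simp add: L2_norm_wave)
  then have "r\<^sup>2 \<le> (sqrt 2)\<^sup>2"
    using zero_le_power2[of "L2_norm (residual \<psi> J (wave (c * t0)))"] by simp
  then have r_le: "r \<le> sqrt 2"
    by (rule power2_le_imp_le) simp
  have "H t0 = (\<Sum>n\<in>J. L2_inner (wave (c * t0)) (\<psi> n) * cnj (L2_inner (wave (c * t0)) (\<psi> n)))"
    unfolding H_def h_def L2_inner_cnj by (rule L2_inner_lincomb_left[OF L2_psi L2_wave])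
  also have "\<dots> = of_real (r\<^sup>2)"
    unfolding rsq complex_norm_square[symmetric] by simp
  finally have Ht0: "cmod (H t0) = r\<^sup>2" by (simp add: norm_power)
  \<comment> \<open>The radius is chosen so that the Lipschitz bound lets \<open>H\<close> lose at
    most half of its value at \<open>t0\<close>.\<close>
  have Hlow: "r\<^sup>2 / 2 \<le> cmod (H t)" if "\<bar>t0 - t\<bar> \<le> r / (2 * sqrt 2 * c)" for t
  proof -
    have "cmod (H t0 - H t) \<le> sqrt 2 * \<bar>c * t0 - c * t\<bar> * r"
      unfolding H_def r_def by (rule inner_wave_lipschitz[OF h2])
    also have "\<bar>c * t0 - c * t\<bar> = c * \<bar>t0 - t\<bar>"
      using c_pos by (simp add: abs_mult flip: right_diff_distrib)
    also have "sqrt 2 * (c * \<bar>t0 - t\<bar>) * r \<le> sqrt 2 * (c * (r / (2 * sqrt 2 * c))) * r"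
      using that c_pos r by (intro mult_left_mono mult_right_mono) auto
    also have "\<dots> = r\<^sup>2 / 2"
      using c_pos by (simp add: power2_eq_square)
    finally show ?thesis
      using norm_triangle_ineq2[of "H t0" "H t"] Ht0 by linarith
  qed
  define \<delta> where "\<delta> = r / (2 * sqrt 2 * c)"
  have "r \<le> sqrt 2 * c" using r_le mult_mono[OF r_le c] r by simp
  then have \<delta>: "0 < \<delta>" "\<delta> \<le> 1 / 2"
    using r c_pos by (auto simp: \<delta>_def field_simps)
  have H2: "H \<in> L2_on I" unfolding H_def[abs_def] by (rule L2_inner_wave[OF h2])
  \<comment> \<open>The interval of length \<open>\<delta> \<le> 1 / 2\<close> extends inwards from
    \<open>t0\<close>, so that it stays in \<open>I\<close> even if \<open>t0\<close> is an
    endpoint.\<close>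
  have "\<delta> * (r\<^sup>2 / 2)\<^sup>2 \<le> (L2_norm H)\<^sup>2"
  proof (cases "t0 \<ge> 0")
    case True
    then have "(t0 - (t0 - \<delta>)) * (r\<^sup>2 / 2)\<^sup>2 \<le> (L2_norm H)\<^sup>2"
      using \<delta> t0 by (intro interval_norm_sq_ge H2 Hlow) (auto simp flip: \<delta>_def)
    then show ?thesis by simp
  next
    case False
    then have "((t0 + \<delta>) - t0) * (r\<^sup>2 / 2)\<^sup>2 \<le> (L2_norm H)\<^sup>2"
      using \<delta> t0 by (intro interval_norm_sq_ge H2 Hlow) (auto simp flip: \<delta>_def)
    then show ?thesis by simp
  qed
  then have "c / (2 * pi) * (\<delta> * (r\<^sup>2 / 2)\<^sup>2) \<le> c / (2 * pi) * (L2_norm H)\<^sup>2"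
    using c_pos by (intro mult_left_mono) auto
  also have "\<dots> = (\<Sum>n\<in>J. \<mu> n * (cmod (L2_inner (wave (c * t0)) (\<psi> n)))\<^sup>2)"
    unfolding H_def[abs_def] h_def by (rule norm_fourier_psi_lincomb[OF J(1)])
  also have "\<dots> \<le> (\<Sum>n\<in>J. \<mu> N * (cmod (L2_inner (wave (c * t0)) (\<psi> n)))\<^sup>2)"
    using J by (intro sum_mono mult_right_mono mu_mono) auto
  also have "\<dots> = \<mu> N * r\<^sup>2"
    by (simp add: rsq sum_distrib_left)
  \<comment> \<open>The \<open>c\<close> in \<open>\<delta>\<close> cancels the prefactor; of the
    fifth power of \<open>r\<close>, two factors are divided out against the right-hand
    side.\<close>
  also have "c / (2 * pi) * (\<delta> * (r\<^sup>2 / 2)\<^sup>2) = r ^ 3 / (16 * sqrt 2 * pi) * r\<^sup>2"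
    using c_pos by (simp add: \<delta>_def field_simps eval_nat_numeral)
  finally have "r ^ 3 / (16 * sqrt 2 * pi) \<le> \<mu> N"
    by (rule mult_right_le_imp_le) (use r in simp)
  then show ?thesis
    unfolding r_def by (simp add: field_simps)
qed

text \<open>The bound for finite tails does not depend on their length, and what lies beyond
  \<open>L\<close> tends to 0 because the eigenfunctions form a basis.\<close>

lemma residual_wave_cube_le:
  assumes t0: "\<bar>t0\<bar> \<le> 1" and c: "c \<ge> 1"
  shows "(L2_norm (residual \<psi> {..<N} (wave (c * t0)))) ^ 3 \<le> 16 * sqrt 2 * pi * \<mu> N"
proof -
  let ?f = "wave (c * t0)"
  \<comment> \<open>A cube root, because the triangle inequality applies to norms and not to their
    cubes.\<close>
  define B where "B = root 3 (16 * sqrt 2 * pi * \<mu> N)"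
  have B: "B ^ 3 = 16 * sqrt 2 * pi * \<mu> N"
    unfolding B_def using mu_pos[of N] by simp
  have B0: "B \<ge> 0"
    unfolding B_def using mu_pos[of N] by simp
  have le: "L2_norm (residual \<psi> {..<N} ?f) \<le> B + L2_norm (residual \<psi> {..<L} ?f)" if "N \<le> L" for L
  proof -
    define h where "h x = (\<Sum>n\<in>{N..<L}. L2_inner ?f (\<psi> n) * \<psi> n x)" for x
    have "(L2_norm h) ^ 3 \<le> B ^ 3"
      unfolding B h_def[abs_def] using t0 c by (intro tail_wave_cube_le) auto
    then have hB: "L2_norm h \<le> B"
      using power_le_imp_le_base[of "L2_norm h" 2 B] B0 by simp
    have "residual \<psi> {..<N} ?f = (\<lambda>x. h x + residual \<psi> {..<L} ?f x)"
    proof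
      fix x
      have "(\<Sum>n<L. L2_inner ?f (\<psi> n) * \<psi> n x) = (\<Sum>n<N. L2_inner ?f (\<psi> n) * \<psi> n x) + h x"
        unfolding h_def lessThan_atLeast0 using that by (intro sum.atLeastLessThan_concat[symmetric]) auto
      then show "residual \<psi> {..<N} ?f x = h x + residual \<psi> {..<L} ?f x"
        by (simp add: residual_def)
    qed
    then have "L2_norm (residual \<psi> {..<N} ?f) \<le> L2_norm h + L2_norm (residual \<psi> {..<L} ?f)"
      by (simp only:) (intro L2_norm_triangle L2_residual orthonormal_psi L2_wave,
        simp add: h_def[abs_def] L2_psi_lincomb)
    then show ?thesis using hB by linarith
  qed
  have "(\<lambda>L. B + L2_norm (residual \<psi> {..<L} ?f)) \<longlonglongrightarrow> B + 0"
    by (intro tendsto_intros residual_tendsto_0 L2_wave)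
  then have "L2_norm (residual \<psi> {..<N} ?f) \<le> B + 0"
    by (rule LIMSEQ_le_const) (use le in auto)
  then have "(L2_norm (residual \<psi> {..<N} ?f)) ^ 3 \<le> B ^ 3"
    by (intro power_mono) auto
  then show ?thesis unfolding B .
qed

end

section \<open>Frequencies outside the band\<close>

lemma binomial_le_power: "n choose k \<le> n ^ k"
  by (cases "k \<le> n") (auto simp: binomial_le_pow binomial_eq_0)

text \<open>A Chernoff bound: the factor \<open>exp (2 * (j - m))\<close> is at least 1 on the discarded terms.\<close>

lemma binomial_truncation:
  fixes z :: complex
  assumes "cmod z \<le> \<theta>"
  shows "cmod ((1 + z) ^ P - (\<Sum>j<m. of_nat (P choose j) * z ^ j)) \<le> exp (exp 2 * (\<theta> * P) - 2 * m)"
proof -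
  have \<theta>: "\<theta> \<ge> 0" using assms norm_ge_zero[of z] by linarith
  \<comment> \<open>\<open>m\<close> may exceed \<open>P\<close>; the intersection removes the
    vanishing terms, so that the sum is a part of the full binomial expansion.\<close>
  have "(\<Sum>j<m. of_nat (P choose j) * z ^ j) = (\<Sum>j\<in>{..<m} \<inter> {..P}. of_nat (P choose j) * z ^ j)"
    by (intro sum.mono_neutral_right) (auto simp: binomial_eq_0)
  moreover have "(1 + z) ^ P = (\<Sum>j\<le>P. of_nat (P choose j) * z ^ j)"
    using binomial_ring[of z 1 P] by (simp add: add.commute)
  moreover have "(\<Sum>j\<le>P. of_nat (P choose j) * z ^ j) = (\<Sum>j\<in>{..<m} \<inter> {..P}. of_nat (P choose j) * z ^ j)
    + (\<Sum>j\<in>{..P} - {..<m} \<inter> {..P}. of_nat (P choose j) * z ^ j)"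
    by (subst add.commute, rule sum.subset_diff) auto
  ultimately have "(1 + z) ^ P - (\<Sum>j<m. of_nat (P choose j) * z ^ j)
    = (\<Sum>j\<in>{..P} - {..<m} \<inter> {..P}. of_nat (P choose j) * z ^ j)"
    by simp
  also have "cmod \<dots> \<le> (\<Sum>j\<in>{..P} - {..<m} \<inter> {..P}. exp (- 2 * real m) * (real (P choose j) * (exp 2 * \<theta>) ^ j))"
  proof (rule sum_norm_le)
    fix j assume j: "j \<in> {..P} - {..<m} \<inter> {..P}"
    then have "m \<le> j" by auto
    have "cmod (of_nat (P choose j) * z ^ j) \<le> real (P choose j) * \<theta> ^ j"
      using assms by (simp add: norm_mult norm_power mult_left_mono power_mono)
    also have "\<dots> \<le> (real (P choose j) * \<theta> ^ j) * exp (2 * (real j - real m))"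
      using mult_left_mono[of 1 "exp (2 * (real j - real m))" "real (P choose j) * \<theta> ^ j"] \<open>m \<le> j\<close> \<theta>
      by simp
    also have "exp (2 * (real j - real m)) = exp (- 2 * real m) * exp 2 ^ j"
      by (simp flip: exp_of_nat_mult exp_add add: algebra_simps)
    finally show "cmod (of_nat (P choose j) * z ^ j)
      \<le> exp (- 2 * real m) * (real (P choose j) * (exp 2 * \<theta>) ^ j)"
      by (simp add: power_mult_distrib mult_ac)
  qed
  \<comment> \<open>With the weights in place, the sum can be completed to a full binomial
    expansion.\<close>
  also have "\<dots> \<le> (\<Sum>j\<le>P. exp (- 2 * real m) * (real (P choose j) * (exp 2 * \<theta>) ^ j))"
    using \<theta> by (intro sum_mono2) auto
  also have "\<dots> = exp (- 2 * real m) * (1 + exp 2 * \<theta>) ^ P"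
    using binomial_ring[of "exp 2 * \<theta>" 1 P] by (simp add: add.commute sum_distrib_left)
  also have "(1 + exp 2 * \<theta>) ^ P \<le> exp (exp 2 * \<theta>) ^ P"
    using \<theta> exp_ge_add_one_self[of "exp 2 * \<theta>"] by (intro power_mono) auto
  also have "\<dots> = exp (exp 2 * (\<theta> * P))"
    by (simp flip: exp_of_nat_mult add: mult_ac)
  also have "exp (- 2 * real m) * \<dots> = exp (exp 2 * (\<theta> * P) - 2 * m)"
    by (simp flip: exp_add)
  finally show ?thesis by simp
qed

text \<open>Bounding \<open>P choose j\<close> by \<open>P ^ j\<close> and inserting
  \<open>m choose j\<close>, which is at least 1, gives part of a binomial expansion with exponent
  \<open>m\<close> in place of \<open>P\<close>. The sum is the total weight of the waves in the
  truncated series, \<open>2 ^ j\<close> being that of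
  \<open>(wave \<theta> x - 1) ^ j\<close>.\<close>

lemma sum_binomial_two_power_le: "(\<Sum>j<m. real (P choose j) * 2 ^ j) \<le> (1 + 2 * real P) ^ m"
proof -
  have "(\<Sum>j<m. real (P choose j) * 2 ^ j) \<le> (\<Sum>j<m. real (m choose j) * (2 * real P) ^ j)"
  proof (rule sum_mono)
    fix j assume "j \<in> {..<m}"
    then have "1 \<le> m choose j" by (simp add: Suc_le_eq)
    then have "1 * (2 * real P) ^ j \<le> real (m choose j) * (2 * real P) ^ j"
      by (intro mult_right_mono) auto
    moreover have "real (P choose j) \<le> real P ^ j"
      using binomial_le_power[of P j] by (metis of_nat_le_iff of_nat_power)
    then have "real (P choose j) * 2 ^ j \<le> real P ^ j * 2 ^ j"
      by (intro mult_right_mono) auto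
    moreover have "real P ^ j * 2 ^ j = (2 * real P) ^ j"
      by (simp add: power_mult_distrib)
    ultimately show "real (P choose j) * 2 ^ j \<le> real (m choose j) * (2 * real P) ^ j"
      by linarith
  qed
  also have "\<dots> \<le> (\<Sum>j\<le>m. real (m choose j) * (2 * real P) ^ j)"
    by (intro sum_mono2) auto
  also have "\<dots> = (1 + 2 * real P) ^ m"
    using binomial_ring[of "2 * real P" 1 m] by (simp add: add.commute)
  finally show ?thesis .
qed

lemma wave_power: "wave \<theta> x ^ n = wave (real n * \<theta>) x"
  by (simp add: wave_def Complex.DeMoivre mult.assoc)

text \<open>Frequencies outside the band are reached from those inside it by truncating the binomial series
  of \<open>(1 + (wave \<theta> - 1)) ^ P\<close>.\<close>

lemma residual_wave_extrapolate:
  assumes e: "orthonormal_on e J" "finite J"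
    and D: "\<And>i. i < m \<Longrightarrow> L2_norm (residual e J (wave (real i * \<theta>))) \<le> D"
  shows "L2_norm (residual e J (wave (real P * \<theta>)))
    \<le> (\<Sum>j<m. real (P choose j) * 2 ^ j) * D + sqrt 2 * exp (exp 2 * (\<bar>\<theta>\<bar> * P) - 2 * m)"
proof -
  define q where "q j x = (wave \<theta> x - 1) ^ j" for j x
  define p where "p x = (\<Sum>j<m. of_nat (P choose j) * q j x)" for x
  have q2: "q j \<in> L2_on I" for j
    unfolding q_def[abs_def] by (intro L2_continuous continuous_intros)
  have p2: "p \<in> L2_on I"
    unfolding p_def[abs_def] by (intro L2_sum L2_scale q2)
  have q: "L2_norm (residual e J (q j)) \<le> 2 ^ j * D" if "j < m" for j
  proof -
    \<comment> \<open>The frequencies \<open>i * \<theta>\<close> that occur have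
      \<open>i \<le> j < m\<close>, so that \<open>D\<close> controls them; the coefficients have
      absolute sum \<open>2 ^ j\<close>.\<close>
    have "q j = (\<lambda>x. \<Sum>i\<le>j. (of_nat (j choose i) * (- 1) ^ (j - i)) * wave (real i * \<theta>) x)"
    proof
      fix x
      show "q j x = (\<Sum>i\<le>j. (of_nat (j choose i) * (- 1) ^ (j - i)) * wave (real i * \<theta>) x)"
        using binomial_ring[of "wave \<theta> x" "-1" j] by (simp add: q_def wave_power mult_ac)
    qed
    then have "L2_norm (residual e J (q j))
      \<le> (\<Sum>i\<le>j. cmod (of_nat (j choose i) * (- 1) ^ (j - i)) * L2_norm (residual e J (wave (real i * \<theta>))))"
      by (simp only:) (intro norm_residual_sum_le e L2_wave finite_atMost)
    also have "\<dots> \<le> (\<Sum>i\<le>j. real (j choose i) * D)"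
      using D that by (intro sum_mono) (auto simp: norm_mult norm_power intro!: mult_left_mono)
    also have "\<dots> = 2 ^ j * D"
      using choose_row_sum[of j] by (simp flip: sum_distrib_right of_nat_sum)
    finally show ?thesis .
  qed
  have "L2_norm (residual e J p) \<le> (\<Sum>j<m. cmod (of_nat (P choose j)) * L2_norm (residual e J (q j)))"
    unfolding p_def[abs_def] by (intro norm_residual_sum_le e q2 finite_lessThan)
  also have "\<dots> \<le> (\<Sum>j<m. real (P choose j) * (2 ^ j * D))"
    using q by (intro sum_mono mult_mono) auto
  also have "\<dots> = (\<Sum>j<m. real (P choose j) * 2 ^ j) * D"
    by (simp add: sum_distrib_right mult.assoc)
  finally have 1: "L2_norm (residual e J p) \<le> (\<Sum>j<m. real (P choose j) * 2 ^ j) * D" .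
  have 2: "L2_norm (\<lambda>x. wave (real P * \<theta>) x - p x) \<le> sqrt 2 * exp (exp 2 * (\<bar>\<theta>\<bar> * P) - 2 * m)"
  proof (rule L2_norm_le_sup)
    show "(\<lambda>x. wave (real P * \<theta>) x - p x) \<in> borel_measurable (lebesgue_on I)"
      by (intro L2_measurable L2_diff L2_wave p2)
    fix x :: real assume x: "x \<in> I"
    \<comment> \<open>The constant 1 is \<open>wave 0 x\<close>.\<close>
    have "cmod (wave \<theta> x - wave 0 x) \<le> \<bar>\<theta> - 0\<bar> * \<bar>x\<bar>"
      by (rule norm_wave_diff)
    also have "\<dots> \<le> \<bar>\<theta>\<bar>" using x mult_left_le[of "\<bar>x\<bar>" "\<bar>\<theta>\<bar>"] by auto
    finally have "cmod (wave \<theta> x - 1) \<le> \<bar>\<theta>\<bar>" by (simp add: wave_def)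
    from binomial_truncation[OF this, of P m]
    show "cmod (wave (real P * \<theta>) x - p x) \<le> exp (exp 2 * (\<bar>\<theta>\<bar> * P) - 2 * m)"
      by (simp add: p_def q_def wave_power)
  qed simp
  show ?thesis
    using norm_residual_approx[OF e L2_wave p2, of "real P * \<theta>"] 1 2 by linarith
qed

text \<open>One term of a series of nonnegative terms. At \<open>x = n = N\<close> it is the weak
  Stirling bound \<open>N ^ N / fact N \<le> exp N\<close>.\<close>

lemma power_over_fact_le_exp:
  fixes x :: real
  assumes "x \<ge> 0"
  shows "x ^ n / fact n \<le> exp x"
proof -
  have "(\<Sum>k\<in>{n}. x ^ k /\<^sub>R fact k) \<le> (\<Sum>k. x ^ k /\<^sub>R fact k)"
    using assms by (intro sum_le_suminf summable_exp_generic) auto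
  then show ?thesis by (simp add: exp_def divide_inverse_commute)
qed

section \<open>Exponential smallness of the residuals of low frequencies\<close>

context pswf
begin

text \<open>The squared factorial in \<open>mu_le\<close> supplies about \<open>N ^ (2 * N)\<close>.
  After cubing, the weight costs \<open>N ^ (6 * m) \<le> N ^ N\<close>, so a factor
  \<open>N ^ N\<close> remains to beat \<open>(c * exp 1) ^ (2 * N)\<close>. The weight is what the
  extrapolation will lose.\<close>

lemma residual_wave_small:
  assumes t: "\<bar>t\<bar> \<le> c" and c: "c \<ge> 1" and N: "real N \<ge> c\<^sup>2 * exp 7"
    and m: "6 * m \<le> N"
  shows "real N ^ (2 * m) * L2_norm (residual \<psi> {..<N} (wave t)) \<le> 4 * c * exp (- real N)"
proof -
  define x where "x = L2_norm (residual \<psi> {..<N} (wave t))"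
  have N1: "real N \<ge> 1"
  proof -
    have "1 * 1 \<le> c\<^sup>2 * exp 7" using c by (intro mult_mono) auto
    then show ?thesis using N by linarith
  qed
  \<comment> \<open>\<open>mu_le\<close> speaks of successors, so \<open>N = Suc n\<close>; then
    \<open>1 / fact n = N / fact N\<close> brings in the extra factor \<open>N\<close>.\<close>
  then obtain n where n: "N = Suc n" by (cases N) auto
  have "x ^ 3 \<le> 16 * sqrt 2 * pi * \<mu> N"
    using residual_wave_cube_le[of "t / c" N] t c by (simp add: x_def)
  also have "\<dots> \<le> 16 * sqrt 2 * pi * (2 * c / pi * (c ^ N / fact n)\<^sup>2)"
    unfolding n by (intro mult_left_mono mu_le) auto
  also have "\<dots> = 32 * sqrt 2 * c * (real N * (c ^ N / fact N))\<^sup>2"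
    by (simp add: n del: of_nat_Suc power_Suc)
  also have "\<dots> \<le> 32 * 2 * c * (real N * (c ^ N / fact N))\<^sup>2"
    using c sqrt2_less_2 by (intro mult_right_mono mult_left_mono) auto
  finally have x3: "x ^ 3 \<le> 64 * c * (real N * (c ^ N / fact N))\<^sup>2" by simp
  have fac: "c ^ N / fact N * real N ^ N \<le> (c * exp 1) ^ N"
  proof -
    have "c ^ N * (real N ^ N / fact N) \<le> c ^ N * exp (real N)"
      using c by (intro mult_left_mono power_over_fact_le_exp) auto
    also have "\<dots> = (c * exp 1) ^ N"
      by (simp add: power_mult_distrib flip: exp_of_nat_mult)
    finally show ?thesis by simp
  qed
  have "(real N ^ (2 * m) * x) ^ 3 = real N ^ (6 * m) * x ^ 3"
    by (simp add: power_mult_distrib flip: power_mult)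
  also have "\<dots> \<le> real N ^ N * x ^ 3"
    using N1 m by (intro mult_right_mono power_increasing) (auto simp: x_def)
  also have "\<dots> \<le> real N ^ N * (64 * c * (real N * (c ^ N / fact N))\<^sup>2)"
    using x3 by (intro mult_left_mono) auto
  also have "\<dots> = 64 * c * (real N)\<^sup>2 * ((c ^ N / fact N * real N ^ N)\<^sup>2 / real N ^ N)"
    using N1 by (simp add: field_simps power2_eq_square)
  also have "\<dots> \<le> 64 * c * (real N)\<^sup>2 * (((c * exp 1) ^ N)\<^sup>2 / real N ^ N)"
    using c fac by (intro mult_left_mono divide_right_mono power_mono) auto
  also have "((c * exp 1) ^ N)\<^sup>2 / real N ^ N = ((c * exp 1)\<^sup>2 / real N) ^ N"
    by (simp add: power_divide mult.commute flip: power_mult)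
  also have "64 * c * (real N)\<^sup>2 * ((c * exp 1)\<^sup>2 / real N) ^ N
    \<le> 64 * c * (exp (real N))\<^sup>2 * (exp (- 5)) ^ N"
  proof (intro mult_mono power_mono)
    \<comment> \<open>The 7 splits as 2 + 5: the 2 pays for the square of \<open>exp 1\<close>; of
      the 5, 2 absorb the bound of \<open>N\<close> by \<open>exp N\<close>, squared, and 3 remain
      for the cube of \<open>exp (- N)\<close>.\<close>
    have "exp (7 :: real) = exp 1 ^ 2 * exp 5"
      by (simp flip: exp_of_nat_mult exp_add)
    then have "(c * exp 1)\<^sup>2 * exp 5 \<le> real N"
      using N by (simp add: power_mult_distrib mult.assoc)
    then show "(c * exp 1)\<^sup>2 / real N \<le> exp (- 5)"
      using N1 by (simp add: exp_minus field_simps)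
    show "real N \<le> exp (real N)"
      using exp_ge_add_one_self[of "real N"] by linarith
  qed (use c in auto)
  also have "\<dots> = 64 * c * exp (- real N) ^ 3"
    by (simp flip: exp_of_nat_mult exp_add add: mult.assoc)
  also have "\<dots> \<le> 64 * c ^ 3 * exp (- real N) ^ 3"
    using c power_increasing[of 1 3 c] by (intro mult_right_mono mult_left_mono) auto
  also have "\<dots> = (4 * c * exp (- real N)) ^ 3"
    by (simp add: power_mult_distrib)
  finally show ?thesis
    using power_le_imp_le_base[of "real N ^ (2 * m) * x" 2 "4 * c * exp (- real N)"] c
    by (simp add: x_def)
qed

text \<open>Extrapolation with \<open>m = N div 6\<close>, the largest value that
  \<open>residual_wave_small\<close> allows, and with \<open>P\<close> so large that the first
  \<open>m\<close> multiples of \<open>\<omega> / P\<close> are at most 1, hence in the band. The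
  coefficient sum stays below \<open>N ^ (2 * m)\<close>, the weight available there.\<close>

lemma residual_wave_le:
  assumes \<omega>: "\<bar>\<omega>\<bar> \<le> pi * real N / 500" and c: "c \<ge> 1" and N: "real N \<ge> c\<^sup>2 * exp 7"
  shows "L2_norm (residual \<psi> {..<N} (wave \<omega>)) \<le> (4 * c + 2) * exp (- real N / 12)"
proof -
  \<comment> \<open>A crude lower bound for \<open>N\<close>, so that the rounding in
    \<open>N div 6\<close> does no harm: it yields \<open>N \<le> 12 * m\<close>.\<close>
  have "2 ^ 7 \<le> exp (1 :: real) ^ 7"
    using exp_ge_add_one_self[of 1] by (intro power_mono) auto
  then have "128 \<le> exp (7 :: real)" by (simp flip: exp_of_nat_mult)
  then have "1 * 128 \<le> c\<^sup>2 * exp 7" using c by (intro mult_mono) auto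
  then have N128: "N \<ge> 128" using N by linarith
  define m where "m = N div 6"
  define P where "P = m * N"
  have m: "6 * m \<le> N" "N < 6 * m + 6" "m > 0"
    using N128 by (auto simp: m_def)
  have m12: "real N \<le> 12 * real m" using m N128 by linarith
  have P: "P > 0" using m N128 by (simp add: P_def)
  define \<theta> where "\<theta> = \<omega> / P"
  have P\<theta>: "real P * \<theta> = \<omega>" using P by (simp add: \<theta>_def)
  have N0: "real N > 0" using N128 by simp
  define D where "D = 4 * c * exp (- real N) / real N ^ (2 * m)"
  have "L2_norm (residual \<psi> {..<N} (wave (real i * \<theta>))) \<le> D" if "i < m" for i
  proof -
    have "\<bar>real i * \<theta>\<bar> = real i / real m * (\<bar>\<omega>\<bar> / real N)"
      by (simp add: \<theta>_def P_def abs_mult)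
    also have "\<dots> \<le> 1 * 1"
    proof (intro mult_mono)
      have le: "pi * real N / 500 \<le> real N" using pi_less_4 N0 by (simp add: field_simps)
      show "\<bar>\<omega>\<bar> / real N \<le> 1" using order_trans[OF \<omega> le] N0 by simp
    qed (use that in auto)
    finally have "\<bar>real i * \<theta>\<bar> \<le> c" using c by linarith
    from residual_wave_small[OF this c N m(1)] show ?thesis
      using N0 by (simp add: D_def field_simps)
  qed
  then have "L2_norm (residual \<psi> {..<N} (wave (real P * \<theta>)))
      \<le> (\<Sum>j<m. real (P choose j) * 2 ^ j) * D + sqrt 2 * exp (exp 2 * (\<bar>\<theta>\<bar> * P) - 2 * m)"
    by (intro residual_wave_extrapolate orthonormal_psi) auto
  also have "(\<Sum>j<m. real (P choose j) * 2 ^ j) * D \<le> (real N ^ (2 * m)) * D"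
  proof (rule mult_right_mono)
    have "(\<Sum>j<m. real (P choose j) * 2 ^ j) \<le> (1 + 2 * real P) ^ m"
      by (rule sum_binomial_two_power_le)
    also have "\<dots> \<le> ((real N)\<^sup>2) ^ m"
    proof (rule power_mono)
      have "6 * real m \<le> real N" using m by linarith
      then have "6 * real m * real N \<le> real N * real N" by (intro mult_right_mono) auto
      moreover have "2 * 2 \<le> real N * real N" using N128 by (intro mult_mono) auto
      ultimately show "1 + 2 * real P \<le> (real N)\<^sup>2" by (simp add: P_def power2_eq_square)
    qed simp
    finally show "(\<Sum>j<m. real (P choose j) * 2 ^ j) \<le> real N ^ (2 * m)"
      by (simp flip: power_mult)
  qed (use c in \<open>simp add: D_def\<close>)
  also have "(real N ^ (2 * m)) * D = 4 * c * exp (- real N)"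
    using N0 by (simp add: D_def)
  also have "\<dots> \<le> 4 * c * exp (- real N / 12)"
    using c by (intro mult_left_mono) auto
  also have "sqrt 2 * exp (exp 2 * (\<bar>\<theta>\<bar> * P) - 2 * m) \<le> 2 * exp (- real N / 12)"
  proof (intro mult_mono)
    \<comment> \<open>Here 500 is decisive: the exponent is at most
      \<open>9 * 4 * N / 500 - N / 6\<close>, about \<open>- 0.095 * N\<close>, which lies below
      \<open>- N / 12\<close>.\<close>
    have "exp (1 :: real) ^ 2 \<le> 3 ^ 2" using exp_le by (intro power_mono) auto
    then have e: "exp (2 :: real) \<le> 9" by (simp flip: exp_of_nat_mult)
    have "\<bar>\<theta>\<bar> * P = \<bar>\<omega>\<bar>" using P\<theta> by (metis abs_mult abs_of_nat mult.commute)
    moreover have "pi * real N \<le> 4 * real N"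
      using pi_less_4 by (intro mult_right_mono) auto
    ultimately have "\<bar>\<theta>\<bar> * P \<le> 4 * real N / 500"
      using \<omega> by linarith
    then have "exp 2 * (\<bar>\<theta>\<bar> * P) \<le> 9 * (4 * real N / 500)"
      using e by (intro mult_mono) auto
    then show "exp (exp 2 * (\<bar>\<theta>\<bar> * P) - 2 * m) \<le> exp (- real N / 12)"
      using m12 by simp
  qed (use sqrt2_less_2 in auto)
  finally show ?thesis
    unfolding P\<theta> by (simp add: algebra_simps)
qed

end

section \<open>Density of trigonometric polynomials\<close>

definition trig :: "int \<Rightarrow> real \<Rightarrow> complex" where
  "trig k x = of_real (1 / sqrt 2) * wave (pi * of_int k) x"

lemma L2_trig: "trig k \<in> L2_on I"
  unfolding trig_def[abs_def] by (intro L2_scale L2_wave)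

lemma trig_eq: "trig k = (\<lambda>x. of_real (1 / sqrt 2) * wave (pi * of_int k) x)"
  by (simp add: trig_def fun_eq_iff)

lemma L2_inner_scale_right: "L2_inner f (\<lambda>x. a * g x) = cnj a * L2_inner f g"
  by (subst (1 2) L2_inner_cnj[symmetric]) (simp add: L2_inner_scale_left)

lemma orthonormal_trig: "orthonormal_on trig J"
proof -
  have "L2_inner (trig k) (trig l) = (if k = l then 1 else 0)" for k l
  proof -
    have "pi * of_int k - pi * of_int l = pi * of_int (k - l)"
      by (simp add: algebra_simps)
    then have "L2_inner (wave (pi * of_int k)) (wave (pi * of_int l)) = (if k = l then 2 else 0)"
      unfolding inner_wave_wave by (simp del: of_int_diff)
    moreover have "complex_of_real (1 / sqrt 2 * (1 / sqrt 2 * 2)) = 1"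
      by simp
    then have "complex_of_real (1 / sqrt 2) * (of_real (1 / sqrt 2) * 2) = 1"
      by (simp only: of_real_mult of_real_numeral)
    ultimately show ?thesis
      unfolding trig_eq L2_inner_scale_left L2_inner_scale_right complex_cnj_complex_of_real
      by (simp del: of_real_divide)
  qed
  then show ?thesis by (simp add: orthonormal_on_def L2_trig)
qed

lemma L2_norm_trig: "L2_norm (trig k) = 1"
  unfolding trig_eq L2_norm_scale L2_norm_wave norm_of_real by simp

lemma fourier_coeff_eq: "fourier_coeff f k = L2_inner f (trig k)"
  unfolding fourier_coeff_def trig_eq L2_inner_scale_right L2_inner_def cnj_wave
  by (simp add: wave_def cis_conv_exp)

section \<open>Functions approximated by their Fourier sums\<close>

abbreviation fourier_residual :: "nat \<Rightarrow> (real \<Rightarrow> complex) \<Rightarrow> real \<Rightarrow> complex" where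
  "fourier_residual K \<equiv> residual trig {- int K..int K}"

text \<open>A closed linear subspace of \<open>L2_on I\<close>, shown to contain in turn the
  trigonometric polynomials, the continuous functions and, by way of the eigenfunctions, all of
  \<open>L2_on I\<close>.\<close>

definition fourier_approximable :: "(real \<Rightarrow> complex) \<Rightarrow> bool" where
  "fourier_approximable f \<longleftrightarrow> f \<in> L2_on I \<and> (\<lambda>K. L2_norm (fourier_residual K f)) \<longlonglongrightarrow> 0"

lemma fourier_approximable_add:
  assumes "fourier_approximable f" "fourier_approximable g"
  shows "fourier_approximable (\<lambda>x. f x + g x)"
  unfolding fourier_approximable_def
proof
  show "(\<lambda>x. f x + g x) \<in> L2_on I"
    using assms by (auto simp: fourier_approximable_def intro: L2_add)
  show "(\<lambda>K. L2_norm (fourier_residual K (\<lambda>x. f x + g x))) \<longlonglongrightarrow> 0"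
  proof (rule Lim_null_comparison)
    show "(\<lambda>K. L2_norm (fourier_residual K f) + L2_norm (fourier_residual K g)) \<longlonglongrightarrow> 0"
      using assms by (intro tendsto_add_zero) (simp_all add: fourier_approximable_def)
    have "L2_norm (fourier_residual K (\<lambda>x. f x + g x))
        \<le> L2_norm (fourier_residual K f) + L2_norm (fourier_residual K g)" for K
      using assms by (intro norm_residual_add orthonormal_trig) (simp_all add: fourier_approximable_def)
    then show "\<forall>\<^sub>F K in sequentially. norm (L2_norm (fourier_residual K (\<lambda>x. f x + g x)))
        \<le> L2_norm (fourier_residual K f) + L2_norm (fourier_residual K g)"
      by simp
  qed
qed

lemma fourier_approximable_scale:
  assumes "fourier_approximable f"
  shows "fourier_approximable (\<lambda>x. a * f x)"
  using assms unfolding fourier_approximable_def norm_residual_scale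
  by (auto intro: L2_scale tendsto_mult_right_zero)

lemma fourier_approximable_zero: "fourier_approximable (\<lambda>x. 0)"
  by (simp add: fourier_approximable_def L2_zero residual_def[abs_def] L2_inner_zero_left L2_norm_def)

lemma fourier_approximable_lincomb:
  assumes "\<And>i. i \<in> J \<Longrightarrow> fourier_approximable (f i)"
  shows "fourier_approximable (\<lambda>x. \<Sum>i\<in>J. v i * f i x)"
  using assms
proof (induction J rule: infinite_finite_induct)
  case (insert i J)
  then show ?case
    by (simp add: fourier_approximable_add[OF fourier_approximable_scale])
qed (auto simp: fourier_approximable_zero)

text \<open>The residuals are contractions, so replacing \<open>f\<close> by a \<open>g\<close>
  within \<open>r / 2\<close> costs at most \<open>r / 2\<close>, uniformly in
  \<open>K\<close>.\<close>

lemma fourier_approximable_closed: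
  assumes f: "f \<in> L2_on I"
    and ex: "\<And>\<epsilon>. \<epsilon> > 0 \<Longrightarrow> \<exists>g. fourier_approximable g \<and> L2_norm (\<lambda>x. f x - g x) < \<epsilon>"
  shows "fourier_approximable f"
  unfolding fourier_approximable_def
proof (intro conjI f LIMSEQ_I)
  fix r :: real assume "r > 0"
  then obtain g where g: "fourier_approximable g" "L2_norm (\<lambda>x. f x - g x) < r / 2"
    using ex[of "r / 2"] by auto
  then obtain K0 where K0: "\<And>K. K \<ge> K0 \<Longrightarrow> L2_norm (fourier_residual K g) < r / 2"
    using LIMSEQ_D[of "\<lambda>K. L2_norm (fourier_residual K g)" 0 "r / 2"] \<open>r > 0\<close>
    by (auto simp: fourier_approximable_def)
  show "\<exists>no. \<forall>K\<ge>no. norm (L2_norm (fourier_residual K f) - 0) < r"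
  proof (intro exI allI impI)
    fix K assume "K \<ge> K0"
    have "L2_norm (fourier_residual K f) \<le> L2_norm (fourier_residual K g) + L2_norm (\<lambda>x. f x - g x)"
      using f g(1) by (intro norm_residual_approx orthonormal_trig) (auto simp: fourier_approximable_def)
    then show "norm (L2_norm (fourier_residual K f) - 0) < r"
      using K0[OF \<open>K \<ge> K0\<close>] g(2) by simp
  qed
qed

lemma fourier_approximable_cong_AE:
  assumes "fourier_approximable g" "f \<in> L2_on I" "AE x in lebesgue_on I. f x = g x"
  shows "fourier_approximable f"
proof (rule fourier_approximable_closed[OF assms(2)])
  have g2: "g \<in> L2_on I" using assms(1) by (simp add: fourier_approximable_def)
  have "L2_norm (\<lambda>x. f x - g x) = L2_norm (\<lambda>x. 0)"
  proof (rule L2_cong_AE)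
    show "AE x in lebesgue_on I. f x - g x = 0"
      using assms(3) by eventually_elim simp
  qed (use assms(2) g2 in \<open>auto intro: L2_measurable L2_diff\<close>)
  then show "\<exists>g. fourier_approximable g \<and> L2_norm (\<lambda>x. f x - g x) < \<epsilon>" if "\<epsilon> > 0" for \<epsilon>
    using assms(1) that by (intro exI[of _ g]) (simp add: L2_norm_def)
qed

text \<open>Generated by closure and not by coefficients, so that products are handled by induction
  on both factors.\<close>

inductive trig_poly :: "(real \<Rightarrow> complex) \<Rightarrow> bool" where
  base: "trig_poly (wave (pi * of_int k))"
| scale: "trig_poly f \<Longrightarrow> trig_poly (\<lambda>x. a * f x)"
| add: "trig_poly f \<Longrightarrow> trig_poly g \<Longrightarrow> trig_poly (\<lambda>x. f x + g x)"

lemma trig_poly_mult: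
  assumes "trig_poly f" "trig_poly g"
  shows "trig_poly (\<lambda>x. f x * g x)"
  using assms
proof (induction f)
  case (base k)
  from this show ?case
  proof (induction g)
    case (base l)
    then show ?case
      using trig_poly.base[of "k + l"] by (simp add: wave_mult algebra_simps)
  next
    case (scale f a)
    then show ?case using trig_poly.scale[of "\<lambda>x. wave (pi * of_int k) x * f x" a] by (simp add: mult_ac)
  next
    case (add f g)
    then show ?case
      using trig_poly.add[of "\<lambda>x. wave (pi * of_int k) x * f x" "\<lambda>x. wave (pi * of_int k) x * g x"]
      by (simp add: distrib_left)
  qed
next
  case (scale f a)
  then show ?case using trig_poly.scale[of "\<lambda>x. f x * g x" a] by (simp add: mult_ac)
next
  case (add f h)
  then show ?case using trig_poly.add[of "\<lambda>x. f x * g x" "\<lambda>x. h x * g x"] by (simp add: distrib_right)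
qed

lemma trig_poly_const: "trig_poly (\<lambda>x. a)"
  using trig_poly.scale[OF trig_poly.base[of 0], of a] by (simp add: wave_def)

lemma trig_poly_cos: "trig_poly (\<lambda>x. of_real (cos (pi * x)))"
proof -
  have "of_real (cos (pi * x)) = 1 / 2 * wave (pi * of_int 1) x + 1 / 2 * wave (pi * of_int (- 1)) x" for x
    by (simp add: complex_eq_iff wave_def)
  then show ?thesis by (simp only:) (intro trig_poly.intros)
qed

lemma trig_poly_sin: "trig_poly (\<lambda>x. of_real (sin (pi * x)))"
proof -
  have "of_real (sin (pi * x)) = - \<i> / 2 * wave (pi * of_int 1) x + \<i> / 2 * wave (pi * of_int (- 1)) x" for x
    by (simp add: complex_eq_iff wave_def)
  then show ?thesis by (simp only:) (intro trig_poly.intros)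
qed

text \<open>\<open>polynomial_function\<close> is defined through real linear functionals, so
  \<open>Re\<close> and \<open>Im\<close> of \<open>p\<close> are real polynomials, for which
  closure under sums and products suffices.\<close>

lemma trig_poly_poly_cos:
  fixes p :: "real \<Rightarrow> complex"
  assumes "polynomial_function p"
  shows "trig_poly (\<lambda>x. p (cos (pi * x)))"
proof -
  have real: "trig_poly (\<lambda>x. of_real (q (cos (pi * x))))" if "real_polynomial_function q" for q
    using that
  proof induction
    case (linear f)
    then interpret bounded_linear f .
    \<comment> \<open>A linear map on the reals is multiplication by its value at 1.\<close>
    have f: "complex_of_real (f (cos (pi * x))) = of_real (cos (pi * x)) * of_real (f 1)" for x
      using scaleR[of "cos (pi * x)" 1] by simp
    show ?case unfolding f by (intro trig_poly_mult trig_poly_cos trig_poly_const)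
  next
    case (add f g)
    then show ?case using trig_poly.add[OF add.IH] by simp
  next
    case (mult f g)
    then show ?case using trig_poly_mult[OF mult.IH] by simp
  qed (simp add: trig_poly_const)
  have "real_polynomial_function (Re \<circ> p)" "real_polynomial_function (Im \<circ> p)"
    using assms bounded_linear_Re bounded_linear_Im by (simp_all add: polynomial_function_def)
  then have "trig_poly (\<lambda>x. of_real ((Re \<circ> p) (cos (pi * x))) + \<i> * of_real ((Im \<circ> p) (cos (pi * x))))"
    by (intro trig_poly.add trig_poly.scale real)
  moreover have "of_real ((Re \<circ> p) u) + \<i> * of_real ((Im \<circ> p) u) = p u" for u
    by (simp add: complex_eq_iff)
  ultimately show ?thesis by (simp only:)
qed

text \<open>The residual of the mode \<open>k\<close> vanishes once
  \<open>K \<ge> \<bar>k\<bar>\<close>; linearity does the rest.\<close>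

lemma fourier_approximable_trig_poly:
  assumes "trig_poly f"
  shows "fourier_approximable f"
  using assms
proof induction
  case (base k)
  have "L2_norm (fourier_residual K (trig k)) = 0" if "K \<ge> nat \<bar>k\<bar>" for K
  proof -
    have k: "k \<in> {- int K..int K}" using that by auto
    have "(L2_norm (fourier_residual K (trig k)))\<^sup>2 = (L2_norm (trig k))\<^sup>2 -
        (\<Sum>i\<in>{- int K..int K}. if i = k then 1 else 0)"
      unfolding norm_residual[OF orthonormal_trig finite_atLeastAtMost_int L2_trig]
      using orthonormal_trig[of UNIV]
      by (intro arg_cong2[where f = "(-)"] sum.cong refl) (auto simp: orthonormal_on_def)
    also have "\<dots> = 0" using k by (simp add: L2_norm_trig)
    finally show ?thesis by simp
  qed
  then have "(\<lambda>K. L2_norm (fourier_residual K (trig k))) \<longlonglongrightarrow> 0"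
    by (intro tendsto_eventually) (auto simp: eventually_sequentially)
  then have "fourier_approximable (\<lambda>x. of_real (sqrt 2) * trig k x)"
    by (intro fourier_approximable_scale) (simp add: fourier_approximable_def L2_trig)
  then show ?case by (simp add: trig_def flip: mult.assoc of_real_mult)
qed (auto intro: fourier_approximable_scale fourier_approximable_add)

lemma fourier_approximable_uniform:
  assumes f: "f \<in> L2_on I" and ex: "\<And>e. e > 0 \<Longrightarrow> \<exists>T. trig_poly T \<and> (\<forall>x\<in>I. cmod (f x - T x) < e)"
  shows "fourier_approximable f"
proof (rule fourier_approximable_closed[OF f])
  fix \<epsilon> :: real assume "\<epsilon> > 0"
  then obtain T where T: "trig_poly T" "\<forall>x\<in>I. cmod (f x - T x) < \<epsilon> / 2"
    using ex[of "\<epsilon> / 2"] by auto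
  have T': "fourier_approximable T" by (rule fourier_approximable_trig_poly[OF T(1)])
  have "L2_norm (\<lambda>x. f x - T x) \<le> sqrt 2 * (\<epsilon> / 2)"
    using T \<open>\<epsilon> > 0\<close> f T'
    by (intro L2_norm_le_sup) (auto simp: fourier_approximable_def intro: less_imp_le L2_measurable L2_diff)
  also have "\<dots> < 2 * (\<epsilon> / 2)"
    using \<open>\<epsilon> > 0\<close> sqrt2_less_2 by (intro mult_strict_right_mono) auto
  finally show "\<exists>g. fourier_approximable g \<and> L2_norm (\<lambda>x. f x - g x) < \<epsilon>"
    using T' by auto
qed

text \<open>The substitution \<open>u = cos (pi * x)\<close> reduces this to the polynomial
  Weierstrass theorem on \<open>{-1..1}\<close>. It identifies \<open>x\<close> with
  \<open>- x\<close>, which is why \<open>\<phi>\<close> is even.\<close>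

lemma even_approx_trig_poly:
  fixes \<phi> :: "real \<Rightarrow> complex"
  assumes cont: "continuous_on I \<phi>" and even: "\<And>x. \<phi> (- x) = \<phi> x" and e: "e > 0"
  shows "\<exists>T. trig_poly T \<and> (\<forall>x\<in>I. cmod (\<phi> x - T x) < e)"
proof -
  define h where "h u = \<phi> (arccos u / pi)" for u
  have "continuous_on {-1..1} h"
    unfolding h_def[abs_def]
  proof (rule continuous_on_compose2[OF cont])
    show "continuous_on {-1..1} (\<lambda>u. arccos u / pi)"
      by (intro continuous_intros) auto
    have "- 1 \<le> arccos u / pi \<and> arccos u / pi \<le> 1" if "-1 \<le> u" "u \<le> 1" for u
      using arccos_lbound[OF that] arccos_ubound[OF that] by (auto simp: field_simps intro: order_trans)
    then show "(\<lambda>u. arccos u / pi) ` {-1..1} \<subseteq> I" by auto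
  qed
  then obtain p where p: "polynomial_function p" "\<forall>u\<in>{-1..1}. cmod (h u - p u) < e"
    using Stone_Weierstrass_polynomial_function[of "{-1..1}" h e] e by auto
  have h: "h (cos (pi * x)) = \<phi> x" if "x \<in> I" for x
  proof -
    have "pi * \<bar>x\<bar> \<le> pi * 1" using that by (intro mult_left_mono) auto
    then have "arccos (cos (pi * \<bar>x\<bar>)) = pi * \<bar>x\<bar>"
      by (intro arccos_cos) auto
    moreover have "cos (pi * \<bar>x\<bar>) = cos (pi * x)"
      by (cases "x \<ge> 0") auto
    ultimately have "h (cos (pi * x)) = \<phi> \<bar>x\<bar>" by (simp add: h_def)
    then show ?thesis using even[of x] by (cases "x \<ge> 0") auto
  qed
  have "\<forall>x\<in>I. cmod (\<phi> x - p (cos (pi * x))) < e"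
  proof
    fix x assume x: "x \<in> I"
    have "cmod (h (cos (pi * x)) - p (cos (pi * x))) < e" using p(2) by simp
    then show "cmod (\<phi> x - p (cos (pi * x))) < e" by (simp only: h[OF x])
  qed
  then show ?thesis using trig_poly_poly_cos[OF p(1)] by blast
qed

lemma fourier_approximable_even:
  assumes "continuous_on I \<phi>" "\<And>x. \<phi> (- x) = \<phi> x"
  shows "fourier_approximable \<phi>"
  using assms by (intro fourier_approximable_uniform L2_continuous even_approx_trig_poly)

text \<open>An approximant of \<open>\<phi>\<close> times the sine is a trigonometric polynomial,
  and the error does not grow since the sine is bounded by 1. This is the step from even to odd
  functions.\<close>

lemma fourier_approximable_sin_even:
  assumes cont: "continuous_on I \<phi>" and even: "\<And>x. \<phi> (- x) = \<phi> x"
  shows "fourier_approximable (\<lambda>x. of_real (sin (pi * x)) * \<phi> x)"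
proof (rule fourier_approximable_uniform)
  show "(\<lambda>x. of_real (sin (pi * x)) * \<phi> x) \<in> L2_on I"
    by (intro L2_continuous continuous_intros cont)
  fix e :: real assume "e > 0"
  then obtain T where T: "trig_poly T" "\<forall>x\<in>I. cmod (\<phi> x - T x) < e"
    using even_approx_trig_poly[OF cont even] by blast
  have "cmod (of_real (sin (pi * x)) * \<phi> x - of_real (sin (pi * x)) * T x) < e" if "x \<in> I" for x
  proof -
    have "cmod (of_real (sin (pi * x)) * \<phi> x - of_real (sin (pi * x)) * T x)
        = \<bar>sin (pi * x)\<bar> * cmod (\<phi> x - T x)"
      by (simp add: norm_mult flip: right_diff_distrib)
    also have "\<dots> \<le> 1 * cmod (\<phi> x - T x)"
      by (intro mult_right_mono) auto
    finally show ?thesis using T(2) that by fastforce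
  qed
  then show "\<exists>T. trig_poly T \<and> (\<forall>x\<in>I. cmod (of_real (sin (pi * x)) * \<phi> x - T x) < e)"
    using trig_poly_mult[OF trig_poly_sin T(1)] by blast
qed

text \<open>An odd \<open>\<phi>\<close> is the limit of \<open>s * (\<phi> * s / (s\<^sup>2 + \<epsilon>))\<close> with \<open>s = sin (pi * x)\<close>, where the second
  factor is even and continuous. The limit is only in \<open>L\<^sup>2\<close>, since \<open>\<phi>\<close> need not vanish at \<open>\<plusminus>1\<close>.\<close>

lemma fourier_approximable_odd:
  assumes cont: "continuous_on I \<phi>" and odd: "\<And>x. \<phi> (- x) = - \<phi> x"
  shows "fourier_approximable \<phi>"
proof (rule fourier_approximable_closed)
  show \<phi>2: "\<phi> \<in> L2_on I" by (rule L2_continuous[OF cont])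
  define s where "s x = sin (pi * x)" for x
  define \<epsilon> where "\<epsilon> n = inverse (real (Suc n))" for n
  have \<epsilon>: "\<epsilon> n > 0" for n by (simp add: \<epsilon>_def)
  have pos: "(s x)\<^sup>2 + \<epsilon> n > 0" for x n using \<epsilon>[of n] by (simp add: add_nonneg_pos)
  define g where "g n x = of_real (s x) * (\<phi> x * of_real (s x / ((s x)\<^sup>2 + \<epsilon> n)))" for n x
  have g: "fourier_approximable (g n)" for n
    unfolding g_def[abs_def] s_def
  proof (rule fourier_approximable_sin_even)
    have "(sin (pi * x))\<^sup>2 + \<epsilon> n \<noteq> 0" for x using pos[of x n] by (simp add: s_def)
    then show "continuous_on I (\<lambda>x. \<phi> x * of_real (sin (pi * x) / ((sin (pi * x))\<^sup>2 + \<epsilon> n)))"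
      by (intro continuous_intros cont) auto
  qed (simp add: odd)
  \<comment> \<open>The error factor lies between 0 and 1 and tends to 0 wherever \<open>s x\<close>
    is nonzero, as dominated convergence requires.\<close>
  have diff: "cmod (\<phi> x - g n x) = cmod (\<phi> x) * (\<epsilon> n / ((s x)\<^sup>2 + \<epsilon> n))" for n x
  proof -
    have "\<phi> x - g n x = \<phi> x * of_real (1 - (s x)\<^sup>2 / ((s x)\<^sup>2 + \<epsilon> n))"
      by (simp add: g_def power2_eq_square algebra_simps)
    also have "1 - (s x)\<^sup>2 / ((s x)\<^sup>2 + \<epsilon> n) = \<epsilon> n / ((s x)\<^sup>2 + \<epsilon> n)"
      using pos[of x n] by (simp add: field_simps)
    finally show ?thesis using pos[of x n] \<epsilon>[of n] by (simp only: norm_mult norm_of_real) simp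
  qed
  have "(\<lambda>n. LINT x|lebesgue_on I. (cmod (\<phi> x - g n x))\<^sup>2) \<longlonglongrightarrow> (LINT x|lebesgue_on I. 0)"
  proof (rule integral_dominated_convergence)
    show "integrable (lebesgue_on I) (\<lambda>x. (cmod (\<phi> x))\<^sup>2)" by (rule L2_integrable_sq[OF \<phi>2])
    have "(\<lambda>x. \<phi> x - g n x) \<in> borel_measurable (lebesgue_on I)" for n
      using g \<phi>2 by (intro L2_measurable L2_diff) (auto simp: fourier_approximable_def)
    then show "(\<lambda>x. (cmod (\<phi> x - g n x))\<^sup>2) \<in> borel_measurable (lebesgue_on I)" for n
      by measurable
    show "AE x in lebesgue_on I. norm ((cmod (\<phi> x - g n x))\<^sup>2) \<le> (cmod (\<phi> x))\<^sup>2" for n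
    proof (intro AE_I2)
      fix x
      have "\<epsilon> n / ((s x)\<^sup>2 + \<epsilon> n) \<le> 1" using pos[of x n] by (simp add: field_simps)
      then have "cmod (\<phi> x - g n x) \<le> cmod (\<phi> x) * 1"
        unfolding diff by (intro mult_left_mono) auto
      then show "norm ((cmod (\<phi> x - g n x))\<^sup>2) \<le> (cmod (\<phi> x))\<^sup>2"
        by (simp add: power_mono)
    qed
    \<comment> \<open>\<open>s\<close> vanishes only at integers, so pointwise convergence can fail
      only on a null set.\<close>
    have "range real_of_int \<in> null_sets lebesgue"
      by (intro null_sets_completionI countable_imp_null_set_lborel) simp
    then have "AE x in lebesgue. x \<notin> range real_of_int" by (rule AE_not_in)
    then have "AE x in lebesgue_on I. x \<notin> range real_of_int"
      by (subst AE_restrict_space_iff) auto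
    then show "AE x in lebesgue_on I. (\<lambda>n. (cmod (\<phi> x - g n x))\<^sup>2) \<longlonglongrightarrow> 0"
    proof eventually_elim
      case (elim x)
      have "s x \<noteq> 0"
        using elim unfolding s_def by (auto simp: sin_zero_iff_int2)
      have "(\<lambda>n. \<epsilon> n / ((s x)\<^sup>2 + \<epsilon> n)) \<longlonglongrightarrow> 0 / ((s x)\<^sup>2 + 0)"
        unfolding \<epsilon>_def using \<open>s x \<noteq> 0\<close> by (intro tendsto_intros LIMSEQ_inverse_real_of_nat) auto
      then have "(\<lambda>n. (cmod (\<phi> x) * (\<epsilon> n / ((s x)\<^sup>2 + \<epsilon> n)))\<^sup>2) \<longlonglongrightarrow> (cmod (\<phi> x) * 0)\<^sup>2"
        by (intro tendsto_intros) simp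
      then show ?case by (simp add: diff)
    qed
  qed auto
  then have "(\<lambda>n. L2_norm (\<lambda>x. \<phi> x - g n x)) \<longlonglongrightarrow> sqrt 0"
    unfolding L2_norm_def by (intro tendsto_real_sqrt) simp
  then have lim: "(\<lambda>n. L2_norm (\<lambda>x. \<phi> x - g n x)) \<longlonglongrightarrow> 0" by simp
  show "\<exists>h. fourier_approximable h \<and> L2_norm (\<lambda>x. \<phi> x - h x) < r" if "r > 0" for r
  proof -
    obtain n where "L2_norm (\<lambda>x. \<phi> x - g n x) < r"
      using order_tendstoD(2)[OF lim \<open>r > 0\<close>] by (auto simp: eventually_sequentially)
    then show ?thesis using g[of n] by blast
  qed
qed

text \<open>Split into even and odd parts. A mismatch of the values at -1 and 1 falls to the odd
  part, where the approximation is only in the mean.\<close>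

lemma fourier_approximable_continuous:
  assumes cont: "continuous_on I \<phi>"
  shows "fourier_approximable \<phi>"
proof -
  have refl: "continuous_on I (\<lambda>x. \<phi> (- x))"
    by (rule continuous_on_compose2[OF cont]) (auto intro: continuous_intros)
  have "fourier_approximable (\<lambda>x. (\<phi> x + \<phi> (- x)) / 2)"
    by (rule fourier_approximable_even) (auto intro!: continuous_intros cont refl)
  moreover have "fourier_approximable (\<lambda>x. (\<phi> x - \<phi> (- x)) / 2)"
    by (rule fourier_approximable_odd) (auto intro!: continuous_intros cont refl simp: field_simps)
  ultimately have "fourier_approximable (\<lambda>x. (\<phi> x + \<phi> (- x)) / 2 + (\<phi> x - \<phi> (- x)) / 2)"
    by (rule fourier_approximable_add)
  then show ?thesis by (simp add: field_simps)
qed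

text \<open>The eigenfunctions are dense, and \<open>\<psi> n = Q c (\<psi> n) / \<mu> n\<close> is continuous up to a null set.\<close>

lemma (in pswf) fourier_approximable_L2:
  assumes f: "f \<in> L2_on I"
  shows "fourier_approximable f"
proof (rule fourier_approximable_closed[OF f])
  have psi: "fourier_approximable (\<psi> n)" for n
  proof (rule fourier_approximable_cong_AE[OF _ L2_psi])
    show "fourier_approximable (\<lambda>x. of_real (1 / \<mu> n) * Q c (\<psi> n) x)"
      by (intro fourier_approximable_scale fourier_approximable_continuous continuous_on_Q c_pos L2_psi)
    show "AE x in lebesgue_on I. \<psi> n x = of_real (1 / \<mu> n) * Q c (\<psi> n) x"
      using eigen[of n] by eventually_elim (use mu_pos[of n] in simp)
  qed
  fix \<epsilon> :: real assume "\<epsilon> > 0"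
  then obtain N where "L2_norm (residual \<psi> {..<N} f) < \<epsilon>"
    using order_tendstoD(2)[OF residual_tendsto_0[OF f]] by (auto simp: eventually_sequentially)
  moreover have "fourier_approximable (\<lambda>x. \<Sum>n<N. L2_inner f (\<psi> n) * \<psi> n x)"
    by (intro fourier_approximable_lincomb psi)
  ultimately show "\<exists>g. fourier_approximable g \<and> L2_norm (\<lambda>x. f x - g x) < \<epsilon>"
    unfolding residual_def[abs_def] by blast
qed

section \<open>Approximation in Sobolev spaces\<close>

lemma sum_le_H_per_norm_sq:
  assumes "finite B" "H_per_norm_sq s f \<noteq> \<infinity>"
  shows "(\<Sum>k\<in>B. (1 + (of_int k * pi)\<^sup>2) powr s * (cmod (fourier_coeff f k))\<^sup>2) \<le> enn2real (H_per_norm_sq s f)"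
    (is "sum ?w B \<le> _")
proof -
  have "ennreal (sum ?w B) = (\<Sum>k\<in>B. ennreal (?w k))"
    by (rule sum_ennreal[symmetric]) simp
  also have "\<dots> \<le> H_per_norm_sq s f"
    unfolding H_per_norm_sq_def using assms(1)
    by (subst nonneg_infsum_complete) (auto intro!: SUP_upper)
  finally have "enn2real (ennreal (sum ?w B)) \<le> enn2real (H_per_norm_sq s f)"
    using assms(2) by (intro enn2real_mono) (auto simp: top.not_eq_extremum)
  then show ?thesis by (simp add: sum_nonneg)
qed

text \<open>Every mode with \<open>\<bar>k\<bar> > K\<close> has Sobolev weight at least
  \<open>w\<close>, so any finite set of them carries at most \<open>S / w\<close>.\<close>

lemma fourier_residual_le:
  assumes f: "fourier_approximable f" and s: "s > 0" and H: "H_per_norm_sq s f \<noteq> \<infinity>"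
  shows "L2_norm (fourier_residual K f)
    \<le> (1 + (pi * (real K + 1))\<^sup>2) powr (- s / 2) * sqrt (enn2real (H_per_norm_sq s f))"
proof -
  define S where "S = enn2real (H_per_norm_sq s f)"
  define w where "w = (1 + (pi * (real K + 1))\<^sup>2) powr s"
  have w: "w > 0"
    unfolding w_def powr_gt_zero using zero_le_power2[of "pi * (real K + 1)"] by linarith
  have f2: "f \<in> L2_on I" using f by (simp add: fourier_approximable_def)
  have le: "(L2_norm (fourier_residual K f))\<^sup>2 \<le> (L2_norm (fourier_residual L f))\<^sup>2 + S / w" if "K \<le> L" for L
  proof -
    define B where "B = {- int L..int L} - {- int K..int K}"
    have "(\<Sum>k\<in>{- int L..int L}. (cmod (L2_inner f (trig k)))\<^sup>2)
      = (\<Sum>k\<in>B. (cmod (L2_inner f (trig k)))\<^sup>2) + (\<Sum>k\<in>{- int K..int K}. (cmod (L2_inner f (trig k)))\<^sup>2)"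
      unfolding B_def using that by (intro sum.subset_diff) auto
    then have "(L2_norm (fourier_residual K f))\<^sup>2
      = (L2_norm (fourier_residual L f))\<^sup>2 + (\<Sum>k\<in>B. (cmod (L2_inner f (trig k)))\<^sup>2)"
      by (simp add: norm_residual[OF orthonormal_trig _ f2])
    moreover have "(\<Sum>k\<in>B. (cmod (L2_inner f (trig k)))\<^sup>2) \<le> S / w"
    proof -
      have "w * (\<Sum>k\<in>B. (cmod (L2_inner f (trig k)))\<^sup>2)
        \<le> (\<Sum>k\<in>B. (1 + (of_int k * pi)\<^sup>2) powr s * (cmod (fourier_coeff f k))\<^sup>2)"
        unfolding sum_distrib_left fourier_coeff_eq
      proof (intro sum_mono mult_right_mono)
        fix k assume "k \<in> B"
        then have "int K + 1 \<le> \<bar>k\<bar>" by (auto simp: B_def)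
        then have "real K + 1 \<le> \<bar>of_int k\<bar>" by linarith
        then have "(real K + 1)\<^sup>2 \<le> \<bar>of_int k\<bar>\<^sup>2"
          by (intro power_mono) auto
        then have "(real K + 1)\<^sup>2 \<le> (of_int k)\<^sup>2" by simp
        then have "(pi * (real K + 1))\<^sup>2 \<le> (of_int k * pi)\<^sup>2"
          unfolding power_mult_distrib mult.commute[of "(of_int k)\<^sup>2"] by (rule mult_left_mono) simp
        then show "w \<le> (1 + (of_int k * pi)\<^sup>2) powr s"
          unfolding w_def using s by (intro powr_mono2) auto
      qed simp
      also have "\<dots> \<le> S"
        unfolding S_def by (rule sum_le_H_per_norm_sq[OF _ H]) (simp add: B_def)
      finally show ?thesis using w by (simp add: field_simps)
    qed
    ultimately show ?thesis by linarith
  qed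
  \<comment> \<open>Letting \<open>L\<close> tend to infinity is where completeness of the Fourier
    modes enters, through \<open>fourier_approximable f\<close>.\<close>
  have "(\<lambda>L. (L2_norm (fourier_residual L f))\<^sup>2 + S / w) \<longlonglongrightarrow> 0\<^sup>2 + S / w"
    using f by (intro tendsto_intros) (simp add: fourier_approximable_def)
  then have "(L2_norm (fourier_residual K f))\<^sup>2 \<le> 0\<^sup>2 + S / w"
    by (rule LIMSEQ_le_const[OF _ exI[of _ K]]) (intro allI impI le)
  then have "L2_norm (fourier_residual K f) \<le> sqrt (S / w)"
    by (intro real_le_rsqrt) simp
  also have "\<dots> = w powr (- (1 / 2)) * sqrt S"
    unfolding powr_minus powr_half_sqrt[OF less_imp_le[OF w]] real_sqrt_divide
    by (simp add: divide_inverse mult.commute)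
  also have "w powr (- (1 / 2)) = (1 + (pi * (real K + 1))\<^sup>2) powr (- s / 2)"
    by (simp add: w_def powr_powr)
  finally show ?thesis unfolding S_def .
qed

text \<open>The factor \<open>500 powr s\<close> is the price of cutting the Fourier series at
  \<open>N / 500\<close> instead of \<open>N\<close>, and 24 that of summing the low modes one by
  one.\<close>

lemma (in pswf) residual_le:
  assumes c: "c \<ge> 1" and N: "real N \<ge> c\<^sup>2 * exp 7" and s: "s > 0"
    and f: "f \<in> L2_on I" and H: "H_per_norm_sq s f \<noteq> \<infinity>"
  shows "L2_norm (residual \<psi> {..<N} f)
    \<le> 500 powr s * (1 + (pi * real N)\<^sup>2) powr (- s / 2) * sqrt (enn2real (H_per_norm_sq s f))
      + 24 * (4 * c + 2) * exp (- real N / 24) * L2_norm f"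
proof -
  define K where "K = N div 500"
  define B where "B = {- int K..int K}"
  define g where "g x = (\<Sum>k\<in>B. L2_inner f (trig k) * trig k x)" for x
  define S where "S = enn2real (H_per_norm_sq s f)"
  have g2: "g \<in> L2_on I" unfolding g_def[abs_def] by (rule L2_lincomb[OF orthonormal_trig])
  have N1: "N \<ge> 1"
  proof -
    have "1 * 1 \<le> c\<^sup>2 * exp 7" using c by (intro mult_mono) auto
    then show ?thesis using N by linarith
  qed
  have high: "L2_norm (\<lambda>x. f x - g x) \<le> 500 powr s * (1 + (pi * real N)\<^sup>2) powr (- s / 2) * sqrt S"
  proof -
    have "(\<lambda>x. f x - g x) = fourier_residual K f"
      by (simp add: residual_def[abs_def] g_def B_def)
    then have "L2_norm (\<lambda>x. f x - g x) \<le> (1 + (pi * (real K + 1))\<^sup>2) powr (- s / 2) * sqrt S"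
      unfolding S_def using fourier_residual_le[OF fourier_approximable_L2[OF f] s H] by simp
    also have "(1 + (pi * (real K + 1))\<^sup>2) powr (- s / 2) \<le> ((1 + (pi * real N)\<^sup>2) / 500\<^sup>2) powr (- s / 2)"
    proof (rule powr_mono2')
      \<comment> \<open>The \<open>+ 1\<close>, from the first discarded mode, makes up for the
        rounding in \<open>N div 500\<close>.\<close>
      have "real N / 500 \<le> real K + 1" unfolding K_def by linarith
      then have "(pi * (real N / 500))\<^sup>2 \<le> (pi * (real K + 1))\<^sup>2"
        by (intro power_mono mult_left_mono) auto
      moreover have "(1 + (pi * real N)\<^sup>2) / 500\<^sup>2 = 1 / 500\<^sup>2 + (pi * (real N / 500))\<^sup>2"
        by (simp add: power_mult_distrib power_divide add_divide_distrib)
      moreover have "1 / 500\<^sup>2 \<le> (1 :: real)" by simp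
      ultimately show "(1 + (pi * real N)\<^sup>2) / 500\<^sup>2 \<le> 1 + (pi * (real K + 1))\<^sup>2"
        by linarith
    qed (use s in \<open>auto intro!: add_pos_nonneg divide_pos_pos\<close>)
    also have "\<dots> = 500 powr s * (1 + (pi * real N)\<^sup>2) powr (- s / 2)"
    proof -
      have "(500\<^sup>2 :: real) powr (- s / 2) = 500 powr (- s)"
      proof -
        have "(500\<^sup>2 :: real) = 500 powr 2" by simp
        then show ?thesis by (simp only: powr_powr) simp
      qed
      then show ?thesis
        by (simp add: powr_divide powr_minus_divide)
    qed
    finally show ?thesis by (simp add: mult_right_mono S_def)
  qed
  have low: "L2_norm (residual \<psi> {..<N} g) \<le> 24 * (4 * c + 2) * exp (- real N / 24) * L2_norm f"
  proof -
    have "L2_norm (residual \<psi> {..<N} g) \<le> (\<Sum>k\<in>B. cmod (L2_inner f (trig k)) * L2_norm (residual \<psi> {..<N} (trig k)))"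
      unfolding g_def[abs_def] by (intro norm_residual_sum_le orthonormal_psi L2_trig) (simp add: B_def)
    also have "\<dots> \<le> (\<Sum>k\<in>B. L2_norm f * ((4 * c + 2) * exp (- real N / 12)))"
    proof (intro sum_mono mult_mono)
      fix k assume k: "k \<in> B"
      show "cmod (L2_inner f (trig k)) \<le> L2_norm f"
        using L2_cauchy_schwarz[OF f L2_trig[of k]] by (simp add: L2_norm_trig)
      have "\<bar>k\<bar> \<le> int K" using k by (auto simp: B_def)
      then have "\<bar>real_of_int k\<bar> \<le> real N / 500" unfolding K_def by linarith
      then have "pi * \<bar>of_int k\<bar> \<le> pi * (real N / 500)" by (intro mult_left_mono) auto
      then have "\<bar>pi * of_int k\<bar> \<le> pi * real N / 500" by (simp add: abs_mult)
      from residual_wave_le[OF this c N]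
      have "1 / sqrt 2 * L2_norm (residual \<psi> {..<N} (wave (pi * of_int k))) \<le> 1 * ((4 * c + 2) * exp (- real N / 12))"
        using c by (intro mult_mono) auto
      then show "L2_norm (residual \<psi> {..<N} (trig k)) \<le> (4 * c + 2) * exp (- real N / 12)"
        unfolding trig_eq norm_residual_scale norm_of_real by simp
    qed auto
    also have "\<dots> = real (2 * K + 1) * (L2_norm f * ((4 * c + 2) * exp (- real N / 12)))"
      by (simp add: B_def nat_add_distrib)
    \<comment> \<open>The number of modes is absorbed by giving up half of the decay rate, from
      \<open>N / 12\<close> to \<open>N / 24\<close>.\<close>
    also have "\<dots> \<le> (24 * exp (real N / 24)) * (L2_norm f * ((4 * c + 2) * exp (- real N / 12)))"
    proof (rule mult_right_mono)
      have "500 * K \<le> N" by (simp add: K_def)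
      then have "2 * K + 1 \<le> N" using N1 by (cases K) simp_all
      then have "real (2 * K + 1) \<le> real N" by (simp only: of_nat_le_iff)
      also have "real N \<le> 24 * exp (real N / 24)"
        using exp_ge_add_one_self[of "real N / 24"] by linarith
      finally show "real (2 * K + 1) \<le> 24 * exp (real N / 24)" .
    qed (use c in simp)
    also have "\<dots> = 24 * (4 * c + 2) * (exp (real N / 24) * exp (- real N / 12)) * L2_norm f"
      by (simp only: mult_ac)
    also have "exp (real N / 24) * exp (- real N / 12) = exp (- real N / 24)"
      by (simp flip: exp_add)
    finally show ?thesis .
  qed
  show ?thesis
    using norm_residual_approx[OF orthonormal_psi finite_lessThan f g2, of N] high low
    unfolding S_def by linarith
qed

text \<open>\<open>H_per\<close> asks for square-integrability on the open interval, while norm and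
  inner product live on \<open>I\<close>; the two endpoints form a null set.\<close>

lemma L2_on_closed_interval:
  assumes "f \<in> L2_on {-1<..<1}"
  shows "f \<in> L2_on I"
proof -
  have eq: "I - {-1, 1} = {-1<..<1 :: real}" by auto
  have null: "{-1, 1} \<in> null_sets (lebesgue_on I)"
    by (simp add: null_sets_restrict_space)
  have m: "f \<in> borel_measurable (lebesgue_on I)"
    using borel_measurable_diff_null[OF null, of f] assms unfolding eq by (simp add: L2_on_def)
  have "(\<lambda>x. (cmod (f x))\<^sup>2) absolutely_integrable_on {-1<..<1}"
    using assms by (simp add: L2_on_def integrable_restrict_space set_integrable_def)
  also have "?this \<longleftrightarrow> (\<lambda>x. (cmod (f x))\<^sup>2) absolutely_integrable_on I"
  proof (rule absolutely_integrable_spike_set_eq)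
    show "negligible {x \<in> I - {-1<..<1}. (cmod (f x))\<^sup>2 \<noteq> 0}"
      by (rule negligible_subset[of "{-1, 1}"]) auto
    show "negligible {x \<in> {-1<..<1} - I. (cmod (f x))\<^sup>2 \<noteq> 0}"
      by (rule negligible_subset[of "{}"]) auto
  qed
  finally show ?thesis
    using m by (simp add: L2_on_def integrable_restrict_space set_integrable_def)
qed

theorem theorem2:
  fixes c :: real
  assumes "c \<ge> 1"
  shows "\<exists>M a. M \<ge> sqrt 2 \<and> a > 0 \<and>
    (\<forall>s::real. s > 0 \<longrightarrow> (\<exists>M'>0.
      \<forall>\<psi> \<mu>. is_PSWF c \<psi> \<mu> \<longrightarrow>
        (\<forall>N::nat. real N \<ge> max (c * M) 3 \<longrightarrow>
          (\<forall>f\<in>H_per s.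
            ennreal (L2_norm (\<lambda>x. f x - partial_sum \<psi> N f x))
              \<le> ennreal (M' * (1 + (pi * real N)\<^sup>2) powr (- s / 2)) * H_per_norm s f
                + ennreal (M' * exp (- a * real N) * L2_norm f)))))"
proof (rule exI[of _ "c * exp 7"], rule exI[of _ "1 / 24"], intro conjI allI impI)
  \<comment> \<open>The witness \<open>c * exp 7\<close> for \<open>M\<close> turns
    \<open>c * M\<close> into the threshold \<open>c^2 * exp 7\<close> of
    \<open>residual_le\<close>.\<close>
  have "sqrt 2 \<le> 1 * 2" using sqrt2_less_2 by simp
  also have "\<dots> \<le> c * exp 7"
    using assms exp_ge_add_one_self[of "7 :: real"] by (intro mult_mono) auto
  finally show "sqrt 2 \<le> c * exp 7" .
  fix s :: real assume s: "s > 0"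
  \<comment> \<open>The sum dominates both constants of \<open>residual_le\<close>; it depends on
    \<open>s\<close> through \<open>500 powr s\<close>, whereas the witnesses for \<open>M\<close>
    and \<open>a\<close> do not.\<close>
  define M' where "M' = 500 powr s + 24 * (4 * c + 2)"
  have M'1: "500 powr s \<le> M'" and M'2: "24 * (4 * c + 2) \<le> M'"
    using assms by (auto simp: M'_def)
  have M'0: "M' > 0"
    using assms unfolding M'_def by (intro add_pos_pos) auto
  show "\<exists>M'>0. \<forall>\<psi> \<mu>. is_PSWF c \<psi> \<mu> \<longrightarrow>
        (\<forall>N::nat. real N \<ge> max (c * (c * exp 7)) 3 \<longrightarrow>
          (\<forall>f\<in>H_per s.
            ennreal (L2_norm (\<lambda>x. f x - partial_sum \<psi> N f x))
              \<le> ennreal (M' * (1 + (pi * real N)\<^sup>2) powr (- s / 2)) * H_per_norm s f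
                + ennreal (M' * exp (- (1 / 24) * real N) * L2_norm f)))"
  proof (intro exI[of _ M'] conjI M'0 allI impI ballI)
    fix \<psi> \<mu> and N :: nat and f
    assume pswf: "is_PSWF c \<psi> \<mu>" and N: "max (c * (c * exp 7)) 3 \<le> real N" and "f \<in> H_per s"
    have "c > 0" using assms by simp
    then interpret pswf c \<psi> \<mu> using pswf by (rule pswf.intro)
    have f: "f \<in> L2_on I"
      using \<open>f \<in> H_per s\<close> by (intro L2_on_closed_interval) (simp add: H_per_def sobolev_def)
    let ?q = "(1 + (pi * real N)\<^sup>2) powr (- s / 2)"
    have q: "?q > 0"
      unfolding powr_gt_zero using zero_le_power2[of "pi * real N"] by linarith
    show "ennreal (L2_norm (\<lambda>x. f x - partial_sum \<psi> N f x))
      \<le> ennreal (M' * ?q) * H_per_norm s f + ennreal (M' * exp (- (1 / 24) * real N) * L2_norm f)"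
    proof (cases "H_per_norm_sq s f = \<infinity>")
      \<comment> \<open>In \<open>ennreal\<close>, \<open>0 * \<infinity> = 0\<close>, so it is the
        positivity of \<open>M' * ?q\<close> that makes the right-hand side infinite.\<close>
      case True
      then show ?thesis
        using M'0 q by (simp add: H_per_norm_def ennreal_mult_top)
    next
      case False
      let ?S = "sqrt (enn2real (H_per_norm_sq s f))"
      have "L2_norm (\<lambda>x. f x - partial_sum \<psi> N f x)
        \<le> 500 powr s * ?q * ?S + 24 * (4 * c + 2) * exp (- real N / 24) * L2_norm f"
        unfolding partial_sum_eq
        using N by (intro residual_le assms s f False) (simp add: power2_eq_square mult.assoc)
      also have "\<dots> \<le> M' * ?q * ?S + M' * exp (- real N / 24) * L2_norm f"
        using q by (intro add_mono mult_right_mono M'1 M'2) auto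
      finally have "ennreal (L2_norm (\<lambda>x. f x - partial_sum \<psi> N f x))
        \<le> ennreal (M' * ?q * ?S + M' * exp (- real N / 24) * L2_norm f)"
        by (rule ennreal_leI)
      also have "\<dots> = ennreal (M' * ?q) * ennreal ?S + ennreal (M' * exp (- real N / 24) * L2_norm f)"
        using M'0 q by (simp add: ennreal_plus ennreal_mult)
      finally show ?thesis using False by (simp add: H_per_norm_def)
    qed
  qed
qed simp

end
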